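(* If $m$ and $n$ both have compact support in $]T_1,T_2[$, then none of the first hyperbolic like curves (i.e. none of the nonempty sets among $C_2^{>++}$, $C_2^{<++}$, $C_2^{>--}$, $C_2^{<--}$, $C_2^{>+-}$, $C_2^{<+-}$, $C_2^{>-+}$, $C_2^{<-+}$) is asymptotic on any side to the trivial horizontal and vertical lines. Conversely, if none of the first hyperbolic like curves is asymptotic on any side to the trivial horizontal and vertical lines, then $m$ and $n$ both have compact support in $]T_1,T_2[$.
   Context: Let $T_1<T_2$ be reals and let $p,q,m,n\in C[T_1,T_2]$ be real-valued with $p>0$, $q\ge 0$ on $[T_1,T_2]$, $m\not\equiv 0$, $n\not\equiv 0$. Put $Lu:=-(p(t)u')'+q(t)u$ and $u^{\pm}:=\max\{\pm u,0\}$. For $(a,b)\in\mathbb{R}^2$ consider the problem $$(P)\qquad Lu=a\,m(t)u^{+}-b\,n(t)u^{-}\ \text{in } ]T_1,T_2[,\qquad u(T_1)=u(T_2)=0,$$ solutions being functions $u\in C^1[T_1,T_2]$ with $pu'\in C^1[T_1,T_2]$. $C_2^{>}$ (resp. $C_2^{<}$) is the set of $(a,b)\in\mathbb{R}^2$ such that $(P)$ has a solution $u$ with exactly one zero in $]T_1,T_2[$ and $u'(T_1)>0$ (resp. $u'(T_1)<0$). With $\mathbb{R}^{+}=]0,+\infty[$, $\mathbb{R}^{-}=]-\infty,0[$, the additional superscripts $++$, $--$, $+-$, $-+$ denote intersection with $\mathbb{R}^{+}\times\mathbb{R}^{+}$, $\mathbb{R}^{-}\times\mathbb{R}^{-}$,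 $\mathbb{R}^{+}\times\mathbb{R}^{-}$, $\mathbb{R}^{-}\times\mathbb{R}^{+}$ respectively. Each of these eight sets, when nonempty, is, up to reflections $(a,b)\mapsto(\pm a,\pm b)$, the graph of a strictly decreasing $C^1$ function from some $]\nu,+\infty[$ onto some $]\mu,+\infty[$, $\nu,\mu\ge0$ (a "hyperbolic like curve"). Such a curve is asymptotic to the horizontal line $\mathbb{R}\times\{\beta\}$ if $b\to\beta$ as $|a|\to+\infty$ with $(a,b)$ on the curve, and asymptotic to the vertical line $\{\alpha\}\times\mathbb{R}$ if $a\to\alpha$ as $|b|\to+\infty$ with $(a,b)$ on the curve. The trivial lines are the vertical lines $\{\lambda_1^m\}\times\mathbb{R}$, $\{\lambda_{-1}^m\}\times\mathbb{R}$ and the horizontal lines $\mathbb{R}\times\{\lambda_1^n\}$, $\mathbb{R}\times\{\lambda_{-1}^n\}$ (those that exist), where $\lambda_1^m$ (resp. $\lambda_{-1}^m$) is the smallest positive (resp. largest negative) eigenvalue of $Lu=\lambda m(t)u$ in $]T_1,T_2[$, $u(T_1)=u(T_2)=0$, which exists iff $m$ takes positive (resp. negative) values in $]T_1,T_2[$; similarly for $n$. "$m$ has compact support in $]T_1,T_2[$" means that the closure of $\{t\in[T_1,T_2]:m(t)\ne0\}$ is contained in $]T_1,T_2[$. *)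

theory Defs
  imports "HOL-Analysis.Analysis" "HOL-Library.Going_To_Filter"
begin

text \<open>Functions on \<open>[T1, T2]\<close> are represented by functions on all of \<open>real\<close> whose values
  outside \<open>{T1..T2}\<close> are irrelevant; derivatives at the end points are one-sided.\<close>

definition deriv_on :: "real \<Rightarrow> real \<Rightarrow> (real \<Rightarrow> real) \<Rightarrow> real \<Rightarrow> real" where
  "deriv_on T1 T2 u t = vector_derivative u (at t within {T1..T2})"

definition C1_on :: "real \<Rightarrow> real \<Rightarrow> (real \<Rightarrow> real) \<Rightarrow> bool" where
  "C1_on T1 T2 u \<longleftrightarrow>
     u differentiable_on {T1..T2} \<and> continuous_on {T1..T2} (deriv_on T1 T2 u)"

definition SL_regular :: "real \<Rightarrow> real \<Rightarrow> (real \<Rightarrow> real) \<Rightarrow> (real \<Rightarrow> real) \<Rightarrow> bool" where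
  "SL_regular T1 T2 p u \<longleftrightarrow>
     C1_on T1 T2 u \<and> C1_on T1 T2 (\<lambda>t. p t * deriv_on T1 T2 u t)"

definition SL_op ::
  "real \<Rightarrow> real \<Rightarrow> (real \<Rightarrow> real) \<Rightarrow> (real \<Rightarrow> real) \<Rightarrow> (real \<Rightarrow> real) \<Rightarrow> real \<Rightarrow> real" where
  "SL_op T1 T2 p q u t =
     - deriv_on T1 T2 (\<lambda>s. p s * deriv_on T1 T2 u s) t + q t * u t"

definition SL_eigenvalue ::
  "real \<Rightarrow> real \<Rightarrow> (real \<Rightarrow> real) \<Rightarrow> (real \<Rightarrow> real) \<Rightarrow> (real \<Rightarrow> real) \<Rightarrow> real \<Rightarrow> bool" where
  "SL_eigenvalue T1 T2 p q w l \<longleftrightarrow>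
     (\<exists>u. SL_regular T1 T2 p u \<and>
          (\<forall>t\<in>{T1<..<T2}. SL_op T1 T2 p q u t = l * w t * u t) \<and>
          u T1 = 0 \<and> u T2 = 0 \<and> (\<exists>t\<in>{T1..T2}. u t \<noteq> 0))"

text \<open>The smallest positive and the largest negative eigenvalue are treated as predicates,
  because either of them may fail to exist.\<close>

definition is_lambda_pos ::
  "real \<Rightarrow> real \<Rightarrow> (real \<Rightarrow> real) \<Rightarrow> (real \<Rightarrow> real) \<Rightarrow> (real \<Rightarrow> real) \<Rightarrow> real \<Rightarrow> bool" where
  "is_lambda_pos T1 T2 p q w l \<longleftrightarrow>
     0 < l \<and> SL_eigenvalue T1 T2 p q w l \<and>
     (\<forall>k. 0 < k \<and> SL_eigenvalue T1 T2 p q w k \<longrightarrow> l \<le> k)"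

definition is_lambda_neg ::
  "real \<Rightarrow> real \<Rightarrow> (real \<Rightarrow> real) \<Rightarrow> (real \<Rightarrow> real) \<Rightarrow> (real \<Rightarrow> real) \<Rightarrow> real \<Rightarrow> bool" where
  "is_lambda_neg T1 T2 p q w l \<longleftrightarrow>
     l < 0 \<and> SL_eigenvalue T1 T2 p q w l \<and>
     (\<forall>k. k < 0 \<and> SL_eigenvalue T1 T2 p q w k \<longrightarrow> k \<le> l)"

text \<open>The values \<open>c\<close> of the trivial lines \<open>{c} \<times> \<real>\<close> (for \<open>w = m\<close>) and \<open>\<real> \<times> {c}\<close>
  (for \<open>w = n\<close>).\<close>

definition trivial_values ::
  "real \<Rightarrow> real \<Rightarrow> (real \<Rightarrow> real) \<Rightarrow> (real \<Rightarrow> real) \<Rightarrow> (real \<Rightarrow> real) \<Rightarrow> real set" where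
  "trivial_values T1 T2 p q w =
     {l. is_lambda_pos T1 T2 p q w l \<or> is_lambda_neg T1 T2 p q w l}"

definition solves_P ::
  "real \<Rightarrow> real \<Rightarrow> (real \<Rightarrow> real) \<Rightarrow> (real \<Rightarrow> real) \<Rightarrow> (real \<Rightarrow> real) \<Rightarrow> (real \<Rightarrow> real)
     \<Rightarrow> real \<Rightarrow> real \<Rightarrow> (real \<Rightarrow> real) \<Rightarrow> bool" where
  "solves_P T1 T2 p q m n a b u \<longleftrightarrow>
     SL_regular T1 T2 p u \<and>
     (\<forall>t\<in>{T1<..<T2}.
        SL_op T1 T2 p q u t = a * m t * max (u t) 0 - b * n t * max (- u t) 0) \<and>
     u T1 = 0 \<and> u T2 = 0"

definition C2_gt ::
  "real \<Rightarrow> real \<Rightarrow> (real \<Rightarrow> real) \<Rightarrow> (real \<Rightarrow> real) \<Rightarrow> (real \<Rightarrow> real) \<Rightarrow> (real \<Rightarrow> real)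
     \<Rightarrow> (real \<times> real) set" where
  "C2_gt T1 T2 p q m n =
     {(a, b). \<exists>u. solves_P T1 T2 p q m n a b u \<and>
        (\<exists>!t. t \<in> {T1<..<T2} \<and> u t = 0) \<and> deriv_on T1 T2 u T1 > 0}"

definition C2_lt ::
  "real \<Rightarrow> real \<Rightarrow> (real \<Rightarrow> real) \<Rightarrow> (real \<Rightarrow> real) \<Rightarrow> (real \<Rightarrow> real) \<Rightarrow> (real \<Rightarrow> real)
     \<Rightarrow> (real \<times> real) set" where
  "C2_lt T1 T2 p q m n =
     {(a, b). \<exists>u. solves_P T1 T2 p q m n a b u \<and>
        (\<exists>!t. t \<in> {T1<..<T2} \<and> u t = 0) \<and> deriv_on T1 T2 u T1 < 0}"

definition open_quadrants :: "(real \<times> real) set set" where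
  "open_quadrants =
     {{0<..} \<times> {0<..}, {..<0} \<times> {..<0}, {0<..} \<times> {..<0}, {..<0} \<times> {0<..}}"

definition first_curves ::
  "real \<Rightarrow> real \<Rightarrow> (real \<Rightarrow> real) \<Rightarrow> (real \<Rightarrow> real) \<Rightarrow> (real \<Rightarrow> real) \<Rightarrow> (real \<Rightarrow> real)
     \<Rightarrow> (real \<times> real) set set" where
  "first_curves T1 T2 p q m n =
     {C \<inter> Q |C Q. C \<in> {C2_gt T1 T2 p q m n, C2_lt T1 T2 p q m n} \<and>
                  Q \<in> open_quadrants \<and> C \<inter> Q \<noteq> {}}"

text \<open>For real \<open>a\<close>, the filter \<open>at_infinity\<close> expresses \<open>\<bar>a\<bar> \<rightarrow> \<infinity>\<close>. The condition that the
  filter is not \<open>bot\<close> says that the curve has points with arbitrarily large \<open>\<bar>a\<bar>\<close>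
  (resp. \<open>\<bar>b\<bar>\<close>), so that the limit is not vacuous.\<close>

definition asymptotic_horizontal :: "(real \<times> real) set \<Rightarrow> real \<Rightarrow> bool" where
  "asymptotic_horizontal C \<beta> \<longleftrightarrow>
     (fst going_to at_infinity within C) \<noteq> bot \<and>
     (snd \<longlongrightarrow> \<beta>) (fst going_to at_infinity within C)"

definition asymptotic_vertical :: "(real \<times> real) set \<Rightarrow> real \<Rightarrow> bool" where
  "asymptotic_vertical C \<alpha> \<longleftrightarrow>
     (snd going_to at_infinity within C) \<noteq> bot \<and>
     (fst \<longlongrightarrow> \<alpha>) (snd going_to at_infinity within C)"

definition compact_support :: "real \<Rightarrow> real \<Rightarrow> (real \<Rightarrow> real) \<Rightarrow> bool" where
  "compact_support T1 T2 w \<longleftrightarrow> closure {t \<in> {T1..T2}. w t \<noteq> 0} \<subseteq> {T1<..<T2}"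

end

theory Submission
  imports Defs
begin

text \<open>
  A solution of the problem with one interior zero \<open>t\<close> and positive slope at \<open>T1\<close> consists of a
  positive arch on \<open>[T1, t]\<close>, which only sees the weight \<open>m\<close>, and a negative arch on \<open>[t, T2]\<close>, which
  only sees \<open>n\<close>. Conversely two such arches can be scaled to have the same slope at \<open>t\<close> and glued
  (\<open>C2_gt_iff\<close>). Hence \<open>a\<close> is a principal eigenvalue for \<open>m\<close> on \<open>[T1, t]\<close> and \<open>b\<close> one
  for \<open>n\<close> on \<open>[t, T2]\<close>, and the curve is parametrised by the node \<open>t\<close>. Exchanging
  \<open>u\<close> and \<open>- u\<close> reduces the case of negative slope to this one (\<open>C2_lt_swap\<close>), and the
  sign changes \<open>(w, l) \<mapsto> (- w, - l)\<close> reduce every quadrant to positive eigenvalues.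

  If \<open>n\<close> vanishes near \<open>T2\<close>, no arch fits into an interval on which \<open>n\<close> is zero, because \<open>q\<close> is
  nonnegative; so the node stays at or below some \<open>s < T2\<close>. The eigenfunction of the first eigenvalue
  \<open>\<alpha>\<close> of the whole interval is positive on \<open>(T1, s]\<close>, and this persists for parameters near \<open>\<alpha>\<close>:
  eigenvalues of the short intervals keep a fixed distance from \<open>\<alpha>\<close> (\<open>first_eig_gap\<close>). No asymptote
  can then be a trivial line.

  If on the other hand \<open>m\<close> takes, say, positive values arbitrarily close to \<open>T2\<close>, consider arches for
  \<open>n\<close> on \<open>[T1, t]\<close> and for \<open>m\<close> on \<open>[t, T2]\<close>. As \<open>t\<close> tends to \<open>T2\<close> the eigenvalue for \<open>m\<close> exists and
  tends to infinity, it is large only when \<open>t\<close> is close to \<open>T2\<close>, and the one for \<open>n\<close> tends to the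
  first eigenvalue of \<open>n\<close> on the whole interval (\<open>weight_at_right_end\<close>): the curve is asymptotic to a
  trivial line. The end point \<open>T1\<close> is treated by the reflection \<open>t \<mapsto> - t\<close>.

  All statements about principal eigenvalues rest on the solution \<open>U l\<close> with initial values
  \<open>u = 0\<close>, \<open>p u' = 1\<close> at the left end point. It depends continuously on \<open>l\<close>, uniformly in \<open>t\<close>
  (\<open>shot_lipschitz\<close>). Being positive up to the right end point and taking a negative value are thus
  open conditions on \<open>l\<close>, and what lies between them is a principal eigenvalue; connectedness of
  intervals produces it (\<open>shot_neg_imp_pos_sol\<close>). Since the weight may change sign, Sturm's comparison
  theorem does not apply. Its substitute is that the parameters \<open>l \<ge> 0\<close> with \<open>U l\<close> positive
  form an interval (\<open>shot_pos_below\<close>), which follows from Picone's identity.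
\<close>

section \<open>The Sturm-Liouville equation as a first-order system\<close>

text \<open>The equation \<open>(p u')' = g u\<close> as a first-order system with \<open>v = p u'\<close>, which avoids second
  derivatives of \<open>u\<close>. The potential \<open>g\<close> is arbitrary so that it can be
  \<open>q - l w\<close>, but also a potential that depends on the sign of \<open>u\<close>.\<close>
definition sl_sol ::
  "(real \<Rightarrow> real) \<Rightarrow> (real \<Rightarrow> real) \<Rightarrow> real \<Rightarrow> real \<Rightarrow> (real \<Rightarrow> real) \<Rightarrow> (real \<Rightarrow> real) \<Rightarrow> bool" where
  "sl_sol p g c d u v \<longleftrightarrow>
     (\<forall>t\<in>{c..d}. (u has_real_derivative v t / p t) (at t within {c..d}) \<and>
                 (v has_real_derivative g t * u t) (at t within {c..d}))"

lemma sl_sol_cont: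
  assumes "sl_sol p g c d u v"
  shows "continuous_on {c..d} u" "continuous_on {c..d} v"
  using assms unfolding sl_sol_def by (auto intro!: DERIV_continuous_on)

lemma sl_sol_deriv:
  assumes "sl_sol p g c d u v" "t \<in> {c..d}"
  shows "(u has_real_derivative v t / p t) (at t within {c..d})"
    "(v has_real_derivative g t * u t) (at t within {c..d})"
  using assms by (simp_all add: sl_sol_def)

lemma sl_sol_deriv_at:
  assumes "sl_sol p g c d u v" "c < t" "t < d"
  shows "(u has_real_derivative v t / p t) (at t)" "(v has_real_derivative g t * u t) (at t)"
proof -
  have "t \<in> {c..d}" "at t within {c..d} = at t"
    using assms at_within_Icc_at[of c t d] by auto
  then show "(u has_real_derivative v t / p t) (at t)" "(v has_real_derivative g t * u t) (at t)"
    using assms(1) unfolding sl_sol_def by force+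
qed

lemma sl_sol_subinterval:
  assumes "sl_sol p g c d u v" "c \<le> c'" "d' \<le> d"
  shows "sl_sol p g c' d' u v"
  unfolding sl_sol_def
proof (intro ballI conjI)
  fix t assume t: "t \<in> {c'..d'}"
  have sub: "{c'..d'} \<subseteq> {c..d}" using assms by auto
  then have "t \<in> {c..d}" using t by blast
  then have "(u has_real_derivative v t / p t) (at t within {c..d})"
    "(v has_real_derivative g t * u t) (at t within {c..d})"
    using assms(1) by (auto simp: sl_sol_def)
  then show "(u has_real_derivative v t / p t) (at t within {c'..d'})"
    "(v has_real_derivative g t * u t) (at t within {c'..d'})"
    using sub DERIV_subset by blast+
qed

lemma sl_sol_combine:
  assumes "sl_sol p g c d u v" "sl_sol p g c d u' v'"
  shows "sl_sol p g c d (\<lambda>t. k * u t + l * u' t) (\<lambda>t. k * v t + l * v' t)"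
  unfolding sl_sol_def
proof (intro ballI conjI)
  fix t assume t: "t \<in> {c..d}"
  have u: "(u has_real_derivative v t / p t) (at t within {c..d})"
    "(u' has_real_derivative v' t / p t) (at t within {c..d})"
    and v: "(v has_real_derivative g t * u t) (at t within {c..d})"
    "(v' has_real_derivative g t * u' t) (at t within {c..d})"
    using assms t by (auto simp: sl_sol_def)
  show "((\<lambda>t. k * u t + l * u' t) has_real_derivative (k * v t + l * v' t) / p t) (at t within {c..d})"
    using DERIV_add[OF DERIV_cmult[OF u(1)] DERIV_cmult[OF u(2)], of k l]
    by (simp add: add_divide_distrib)
  show "((\<lambda>t. k * v t + l * v' t) has_real_derivative g t * (k * u t + l * u' t)) (at t within {c..d})"
    using DERIV_add[OF DERIV_cmult[OF v(1)] DERIV_cmult[OF v(2)], of k l]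
    by (simp add: algebra_simps)
qed

lemma sl_sol_cong:
  assumes "sl_sol p g c d u v" "\<And>t. t \<in> {c..d} \<Longrightarrow> u' t = u t" "\<And>t. t \<in> {c..d} \<Longrightarrow> v' t = v t"
    "\<And>t. t \<in> {c..d} \<Longrightarrow> g' t * u t = g t * u t"
  shows "sl_sol p g' c d u' v'"
  unfolding sl_sol_def
proof (intro ballI conjI)
  fix t assume t: "t \<in> {c..d}"
  have u: "(u has_real_derivative v t / p t) (at t within {c..d})"
    and v: "(v has_real_derivative g t * u t) (at t within {c..d})"
    using assms(1) t by (auto simp: sl_sol_def)
  show "(u' has_real_derivative v' t / p t) (at t within {c..d})"
    by (rule has_field_derivative_transform_within[where d = 1 and f = u]) (use u t assms in auto)
  have "g' t * u' t = g t * u t" using assms(2,4)[OF t] by simp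
  then show "(v' has_real_derivative g' t * u' t) (at t within {c..d})"
    using has_field_derivative_transform_within[OF v, of 1 v'] t assms(3) by auto
qed

text \<open>The function \<open>E t * exp (- K * (t - c)) - D * t\<close> is decreasing.\<close>
lemma gronwall_forward:
  fixes E :: "real \<Rightarrow> real"
  assumes E: "\<And>t. t \<in> {c..d} \<Longrightarrow> (E has_real_derivative E' t) (at t within {c..d})"
    and le: "\<And>t. t \<in> {c..d} \<Longrightarrow> E' t \<le> K * E t + D"
    and "0 \<le> K" "0 \<le> D" and t: "t \<in> {c..d}"
  shows "E t \<le> (E c + D * (t - c)) * exp (K * (t - c))"
proof -
  define H where "H = (\<lambda>s. E s * exp (- K * (s - c)) - D * s)"
  have H: "(H has_real_derivative (E' s - K * E s) * exp (- K * (s - c)) - D) (at s within {c..d})"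
    if "s \<in> {c..d}" for s
    unfolding H_def by (auto intro!: derivative_eq_intros E[OF that] simp: algebra_simps)
  have "H t \<le> H c"
  proof (rule DERIV_nonpos_imp_decreasing_open[of c t H])
    show "c \<le> t" using t by simp
    show "continuous_on {c..t} H"
      using DERIV_continuous_on[OF H] continuous_on_subset[of "{c..d}" H "{c..t}"] t by auto
    fix s assume s: "c < s" "s < t"
    then have sd: "s \<in> {c..d}" "at s within {c..d} = at s"
      using t at_within_Icc_at[of c s d] by auto
    have "(E' s - K * E s) * exp (- K * (s - c)) \<le> D * exp (- K * (s - c))"
      using le[OF sd(1)] by (intro mult_right_mono) auto
    also have "\<dots> \<le> D * 1"
      using assms s by (intro mult_left_mono) auto
    finally show "\<exists>y. (H has_real_derivative y) (at s) \<and> y \<le> 0"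
      using H[OF sd(1)] sd(2) by (intro exI[of _ "(E' s - K * E s) * exp (- K * (s - c)) - D"]) auto
  qed
  then have "E t * exp (- K * (t - c)) \<le> E c + D * (t - c)"
    by (simp add: H_def algebra_simps)
  then have "E t * exp (- K * (t - c)) * exp (K * (t - c)) \<le> (E c + D * (t - c)) * exp (K * (t - c))"
    by (rule mult_right_mono) auto
  then show ?thesis
    by (simp add: mult.assoc flip: exp_add)
qed

lemma gronwall_backward:
  fixes E :: "real \<Rightarrow> real"
  assumes E: "\<And>t. t \<in> {c..d} \<Longrightarrow> (E has_real_derivative E' t) (at t within {c..d})"
    and ge: "\<And>t. t \<in> {c..d} \<Longrightarrow> - (K * E t) \<le> E' t"
    and "0 \<le> K" and t: "t \<in> {c..d}"
  shows "E t \<le> E d * exp (K * (d - t))"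
proof -
  have "((\<lambda>s. E (- s)) has_real_derivative - E' (- s)) (at s within {- d..- c})"
    if "s \<in> {- d..- c}" for s
  proof -
    have "(uminus has_real_derivative - 1) (at s within {- d..- c})"
      by (auto intro!: derivative_eq_intros)
    then show ?thesis
      using DERIV_image_chain[of E "E' (- s)" uminus s "{- d..- c}" "- 1"] E[of "- s"] that
      by (auto simp: o_def)
  qed
  then have "E (- (- t)) \<le> (E (- (- d)) + 0 * (- t - - d)) * exp (K * (- t - - d))"
    using ge t \<open>0 \<le> K\<close> by (intro gronwall_forward[where E = "\<lambda>s. E (- s)" and d = "- c"
      and E' = "\<lambda>s. - E' (- s)"]) (auto simp: minus_le_iff)
  then show ?thesis by (simp add: algebra_simps)
qed

lemma energy_bound:
  fixes p g :: "real \<Rightarrow> real"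
  assumes "continuous_on {c..d} p" "continuous_on {c..d} g" "\<And>t. t \<in> {c..d} \<Longrightarrow> p t > 0"
  obtains K where "K \<ge> 0" "\<And>t. t \<in> {c..d} \<Longrightarrow> \<bar>1 / p t + g t\<bar> \<le> K"
proof -
  have "continuous_on {c..d} (\<lambda>t. 1 / p t + g t)"
    using assms by (intro continuous_intros) (auto simp: less_imp_neq[symmetric] dest!: assms(3))
  then have "bounded ((\<lambda>t. 1 / p t + g t) ` {c..d})"
    using compact_continuous_image compact_imp_bounded compact_Icc by blast
  then obtain K where "K > 0" "\<forall>t\<in>{c..d}. norm (1 / p t + g t) \<le> K"
    unfolding bounded_pos by auto
  then show ?thesis using that[of K] by auto
qed

text \<open>Gronwall's inequality for the energy \<open>u\<^sup>2 + v\<^sup>2\<close>, whose derivative is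
  \<open>2 u v (1 / p + g)\<close>, in both directions from \<open>t0\<close>.\<close>
lemma sl_sol_unique:
  fixes p g :: "real \<Rightarrow> real"
  assumes cont: "continuous_on {c..d} p" "continuous_on {c..d} g"
    and pos: "\<And>t. t \<in> {c..d} \<Longrightarrow> p t > 0"
    and sol: "sl_sol p g c d u v" and t0: "t0 \<in> {c..d}" "u t0 = 0" "v t0 = 0"
    and t: "t \<in> {c..d}"
  shows "u t = 0 \<and> v t = 0"
proof -
  obtain K where K: "K \<ge> 0" "\<And>t. t \<in> {c..d} \<Longrightarrow> \<bar>1 / p t + g t\<bar> \<le> K"
    using energy_bound[OF cont pos] by blast
  define E where "E = (\<lambda>t. (u t)\<^sup>2 + (v t)\<^sup>2)"
  define E' where "E' = (\<lambda>t. 2 * (u t * v t) * (1 / p t + g t))"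
  have E: "(E has_real_derivative E' s) (at s within {c..d})" if "s \<in> {c..d}" for s
    using sol that unfolding E_def E'_def sl_sol_def
    by (auto intro!: derivative_eq_intros simp: algebra_simps)
  have bound: "\<bar>E' s\<bar> \<le> K * E s" if "s \<in> {c..d}" for s
  proof -
    have "\<bar>2 * (u s * v s)\<bar> \<le> E s"
      using sum_squares_bound[of "u s" "v s"] sum_squares_bound[of "u s" "- v s"]
      by (auto simp: E_def abs_le_iff)
    then have "\<bar>2 * (u s * v s)\<bar> * \<bar>1 / p s + g s\<bar> \<le> E s * K"
      using K that by (intro mult_mono) (auto simp: E_def)
    then show ?thesis by (simp add: E'_def abs_mult mult.commute)
  qed
  have E0: "E t0 = 0" using t0 by (simp add: E_def)
  have "E t \<le> 0"
  proof (cases "t \<le> t0")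
    case True
    have "E t \<le> E t0 * exp (K * (t0 - t))"
    proof (rule gronwall_backward[where c = c and E' = E'])
      show "(E has_real_derivative E' s) (at s within {c..t0})" if "s \<in> {c..t0}" for s
        using that t0 by (intro DERIV_subset[OF E]) auto
      show "- (K * E s) \<le> E' s" if "s \<in> {c..t0}" for s
        using bound[of s] that t0 by auto
    qed (use K True t in auto)
    then show ?thesis using E0 by simp
  next
    case False
    have "E t \<le> (E t0 + 0 * (t - t0)) * exp (K * (t - t0))"
    proof (rule gronwall_forward[where d = d and E' = E'])
      show "(E has_real_derivative E' s) (at s within {t0..d})" if "s \<in> {t0..d}" for s
        using that t0 by (intro DERIV_subset[OF E]) auto
      show "E' s \<le> K * E s + 0" if "s \<in> {t0..d}" for s
        using bound[of s] that t0 by auto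
    qed (use K False t in auto)
    then show ?thesis using E0 by simp
  qed
  then show ?thesis
    by (simp add: E_def sum_power2_le_zero_iff)
qed

lemma has_integral_norm_le:
  fixes h k :: "real \<Rightarrow> real"
  assumes "(k has_integral J) S" "(h has_integral I) S" "\<And>s. s \<in> S \<Longrightarrow> norm (h s) \<le> k s"
  shows "norm I \<le> J"
  using integral_norm_bound_integral[of h S k] assms
  by (simp add: has_integral_iff)

text \<open>Integration gains the factor \<open>1 / K\<close> on functions dominated by \<open>exp (K * (t - c))\<close>; for large
  \<open>K\<close> this makes Picard iteration contract on intervals of any length.\<close>
lemma integral_exp_bound:
  fixes h :: "real \<Rightarrow> real"
  assumes "continuous_on {c..d} h" "\<And>s. s \<in> {c..d} \<Longrightarrow> \<bar>h s\<bar> \<le> M * exp (K * (s - c))"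
    and "K > 0" "M \<ge> 0" "t \<in> {c..d}"
  shows "\<bar>integral {c..t} h\<bar> \<le> M / K * exp (K * (t - c))"
proof -
  have "((\<lambda>s. M * exp (K * (s - c))) has_integral
          M / K * exp (K * (t - c)) - M / K * exp (K * (c - c))) {c..t}"
    using assms by (intro fundamental_theorem_of_calculus)
      (auto intro!: derivative_eq_intros simp flip: has_real_derivative_iff_has_vector_derivative)
  moreover have "(h has_integral integral {c..t} h) {c..t}"
    using assms by (intro integrable_integral integrable_continuous_real continuous_on_subset[OF assms(1)]) auto
  moreover have "norm (h s) \<le> M * exp (K * (s - c))" if "s \<in> {c..t}" for s
    using assms(2)[of s] assms(5) that by auto
  ultimately have "norm (integral {c..t} h) \<le> M / K * exp (K * (t - c)) - M / K * exp (K * (c - c))"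
    by (rule has_integral_norm_le)
  moreover have "M / K * exp (K * (c - c)) \<ge> 0" using assms by simp
  ultimately show ?thesis by simp
qed

text \<open>The Picard series: \<open>Y n\<close> and \<open>X (Y n)\<close> are the terms of \<open>v\<close> and \<open>u\<close>, with
  \<open>X (Y n)' = Y n / p\<close> and \<open>Y (n + 1)' = g X (Y n)\<close>. The bounds decay geometrically, so both series
  may be differentiated term by term.\<close>
lemma sl_sol_exists:
  fixes p g :: "real \<Rightarrow> real"
  assumes "c \<le> d" and cont: "continuous_on {c..d} p" "continuous_on {c..d} g"
    and pos: "\<And>t. t \<in> {c..d} \<Longrightarrow> p t > 0"
  shows "\<exists>u v. sl_sol p g c d u v \<and> u c = 0 \<and> v c = 1"
proof -
  have contp: "continuous_on {c..d} (\<lambda>t. 1 / p t)"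
    using cont pos by (intro continuous_intros) (auto simp: less_imp_neq[symmetric] dest!: pos)
  obtain P where P: "P > 0" "\<And>t. t \<in> {c..d} \<Longrightarrow> \<bar>1 / p t\<bar> \<le> P"
    using compact_imp_bounded[OF compact_continuous_image[OF contp compact_Icc]]
    unfolding bounded_pos by auto
  obtain G where G: "G > 0" "\<And>t. t \<in> {c..d} \<Longrightarrow> \<bar>g t\<bar> \<le> G"
    using compact_imp_bounded[OF compact_continuous_image[OF cont(2) compact_Icc]]
    unfolding bounded_pos by auto
  define K where "K = 1 + 2 * (G * P)"
  have GP: "G * P > 0" using G P by simp
  have K: "K \<ge> 1" "K > 0" "G * P / K\<^sup>2 \<le> 1 / 2"
  proof -
    show "K \<ge> 1" "K > 0" using GP by (auto simp: K_def)
    have "2 * (G * P) \<le> K\<^sup>2"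
      using GP zero_le_power2[of "G * P"] by (simp add: K_def power2_eq_square algebra_simps)
    then show "G * P / K\<^sup>2 \<le> 1 / 2" using \<open>K > 0\<close> by (simp add: divide_le_eq)
  qed
  define X where "X = (\<lambda>(y::real \<Rightarrow> real) t. integral {c..t} (\<lambda>s. y s / p s))"
  define Y where "Y = rec_nat (\<lambda>t. 1) (\<lambda>_ y t. integral {c..t} (\<lambda>s. g s * X y s))"
  have Y0: "Y 0 = (\<lambda>t. 1)" and YS: "\<And>n. Y (Suc n) = (\<lambda>t. integral {c..t} (\<lambda>s. g s * X (Y n) s))"
    by (simp_all add: Y_def)
  define Y' where "Y' = (\<lambda>n t. case n of 0 \<Rightarrow> 0 | Suc k \<Rightarrow> g t * X (Y k) t)"
  have Xc: "(X y has_real_derivative y t / p t) (at t within {c..d})" "continuous_on {c..d} (X y)"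
    if y: "continuous_on {c..d} y" and "t \<in> {c..d}" for y t
  proof -
    have cy: "continuous_on {c..d} (\<lambda>s. y s / p s)"
      using continuous_on_mult[OF y contp] by simp
    show "(X y has_real_derivative y t / p t) (at t within {c..d})"
      unfolding X_def using integral_has_real_derivative[OF cy that(2)] .
    show "continuous_on {c..d} (X y)"
      unfolding X_def using integral_has_real_derivative[OF cy] by (rule DERIV_continuous_on)
  qed
  have Xb: "\<bar>X y t\<bar> \<le> P * M / K * exp (K * (t - c))"
    if y: "continuous_on {c..d} y" and b: "\<And>s. s \<in> {c..d} \<Longrightarrow> \<bar>y s\<bar> \<le> M * exp (K * (s - c))"
      and "M \<ge> 0" "t \<in> {c..d}" for y t M
    unfolding X_def
  proof (rule integral_exp_bound)
    show "continuous_on {c..d} (\<lambda>s. y s / p s)"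
      using continuous_on_mult[OF y contp] by simp
    show "\<bar>y s / p s\<bar> \<le> P * M * exp (K * (s - c))" if "s \<in> {c..d}" for s
      using mult_mono[OF P(2)[OF that] b[OF that]] P(1) by (simp add: abs_mult mult.assoc)
  qed (use K P that in auto)
  have cY: "continuous_on {c..d} (Y n)" for n
  proof (induction n)
    case (Suc n)
    have "continuous_on {c..d} (\<lambda>s. g s * X (Y n) s)"
      using Xc(2)[OF Suc, of c] \<open>c \<le> d\<close> cont by (intro continuous_intros) auto
    then show ?case
      unfolding YS by (rule DERIV_continuous_on[OF integral_has_real_derivative])
  qed (simp add: Y0)
  have dY: "(Y n has_real_derivative Y' n t) (at t within {c..d})" if "t \<in> {c..d}" for n t
  proof (cases n)
    case (Suc k)
    have "continuous_on {c..d} (\<lambda>s. g s * X (Y k) s)"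
      using Xc(2)[OF cY, of c] \<open>c \<le> d\<close> cont by (intro continuous_intros) auto
    from integral_has_real_derivative[OF this that] show ?thesis
      by (simp add: Suc YS Y'_def)
  qed (simp add: Y0 Y'_def)
  \<comment> \<open>The weight \<open>exp (K * (t - c))\<close> makes each iteration halve the constant.\<close>
  have bY: "\<bar>Y n t\<bar> \<le> (1 / 2) ^ n * exp (K * (t - c))" if "t \<in> {c..d}" for n t
    using that
  proof (induction n arbitrary: t)
    case 0
    then show ?case using K by (simp add: Y0)
  next
    case (Suc n)
    have bX: "\<bar>X (Y n) s\<bar> \<le> P * (1 / 2) ^ n / K * exp (K * (s - c))" if "s \<in> {c..d}" for s
      using Xb[OF cY Suc.IH _ that] by simp
    have "\<bar>Y (Suc n) t\<bar> \<le> G * (P * (1 / 2) ^ n / K) / K * exp (K * (t - c))"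
      unfolding YS
    proof (rule integral_exp_bound)
      show "continuous_on {c..d} (\<lambda>s. g s * X (Y n) s)"
        using Xc(2)[OF cY, of c] \<open>c \<le> d\<close> cont by (intro continuous_intros) auto
      show "\<bar>g s * X (Y n) s\<bar> \<le> G * (P * (1 / 2) ^ n / K) * exp (K * (s - c))" if "s \<in> {c..d}" for s
        using mult_mono[OF G(2)[OF that] bX[OF that]] G(1) by (simp add: abs_mult mult.assoc)
    qed (use K P G Suc in auto)
    also have "\<dots> = (G * P / K\<^sup>2) * ((1 / 2) ^ n * exp (K * (t - c)))"
      by (simp add: power2_eq_square)
    also have "\<dots> \<le> 1 / 2 * ((1 / 2) ^ n * exp (K * (t - c)))"
      using K by (intro mult_right_mono) auto
    finally show ?case by simp
  qed
  have bX: "\<bar>X (Y n) t\<bar> \<le> P * (1 / 2) ^ n / K * exp (K * (t - c))" if "t \<in> {c..d}" for n t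
    using Xb[OF cY bY _ that] by simp
  define C where "C = exp (K * (d - c))"
  have C: "exp (K * (t - c)) \<le> C" if "t \<in> {c..d}" for t
    using that K by (simp add: C_def)
  have geo: "summable (\<lambda>n. B * (1 / 2) ^ n)" for B :: real
    by (intro summable_mult summable_geometric) auto
  have bY': "norm (Y n t) \<le> C * (1 / 2) ^ n" if "t \<in> {c..d}" for n t
  proof -
    have "(1 / 2) ^ n * exp (K * (t - c)) \<le> (1 / 2) ^ n * C"
      using C[OF that] by (intro mult_left_mono) auto
    then have "\<bar>Y n t\<bar> \<le> (1 / 2) ^ n * C"
      by (rule order_trans[OF bY[OF that]])
    then show ?thesis by (simp add: mult.commute)
  qed
  have bX': "norm (X (Y n) t) \<le> (P / K * C) * (1 / 2) ^ n" if "t \<in> {c..d}" for n t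
  proof -
    have "P * (1 / 2) ^ n / K * exp (K * (t - c)) \<le> P * (1 / 2) ^ n / K * C"
      using C[OF that] K P by (intro mult_left_mono) auto
    then have "\<bar>X (Y n) t\<bar> \<le> P * (1 / 2) ^ n / K * C"
      by (rule order_trans[OF bX[OF that]])
    then show ?thesis by (simp add: mult.commute mult.left_commute)
  qed
  define u where "u = (\<lambda>t. \<Sum>n. X (Y n) t)"
  define v where "v = (\<lambda>t. \<Sum>n. Y n t)"
  have sX: "summable (\<lambda>n. X (Y n) t)" if "t \<in> {c..d}" for t
    using bX'[OF that] by (rule summable_comparison_test'[OF geo])
  have sY: "summable (\<lambda>n. Y n t)" if "t \<in> {c..d}" for t
    using bY'[OF that] by (rule summable_comparison_test'[OF geo])
  have c: "c \<in> {c..d}" using \<open>c \<le> d\<close> by simp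
  have du: "(u has_real_derivative v t / p t) (at t within {c..d})" if t: "t \<in> {c..d}" for t
  proof -
    have "uniform_limit {c..d} (\<lambda>n t. \<Sum>i<n. Y i t / p t) (\<lambda>t. \<Sum>i. Y i t / p t) sequentially"
    proof (rule Weierstrass_m_test[OF _ geo[of "P * C"]])
      fix n s assume s: "s \<in> {c..d}"
      show "norm (Y n s / p s) \<le> P * C * (1 / 2) ^ n"
        using mult_mono[OF P(2)[OF s] bY'[OF s, of n]] P(1) by (simp add: abs_mult mult.assoc)
    qed
    from has_field_derivative_series[OF convex_real_interval(5) Xc(1)[OF cY] this c sX[OF c]]
    have "\<exists>h. \<forall>s\<in>{c..d}. (\<lambda>n. X (Y n) s) sums h s \<and>
        (h has_real_derivative (\<Sum>i. Y i s / p s)) (at s within {c..d})"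
      by blast
    then
    obtain h where h: "\<And>s. s \<in> {c..d} \<Longrightarrow> (\<lambda>n. X (Y n) s) sums h s"
      "\<And>s. s \<in> {c..d} \<Longrightarrow> (h has_real_derivative (\<Sum>i. Y i s / p s)) (at s within {c..d})"
      by blast
    have "(u has_real_derivative (\<Sum>i. Y i t / p t)) (at t within {c..d})"
      by (rule has_field_derivative_transform_within[OF h(2)[OF t], of 1])
        (use h(1) t in \<open>auto simp: u_def sums_iff\<close>)
    then show ?thesis using suminf_divide[OF sY[OF t], of "p t"] by (simp add: v_def)
  qed
  have dv: "(v has_real_derivative g t * u t) (at t within {c..d})" if t: "t \<in> {c..d}" for t
  proof -
    have "uniform_limit {c..d} (\<lambda>n t. \<Sum>i<n. Y' i t) (\<lambda>t. \<Sum>i. Y' i t) sequentially"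
    proof (rule Weierstrass_m_test[OF _ geo[of "2 * (G * (P / K * C))"]])
      fix n s assume s: "s \<in> {c..d}"
      show "norm (Y' n s) \<le> 2 * (G * (P / K * C)) * (1 / 2) ^ n"
      proof (cases n)
        case 0
        then show ?thesis using G P K by (simp add: Y'_def C_def)
      next
        case (Suc k)
        then show ?thesis using mult_mono[OF G(2)[OF s] bX'[OF s, of k]] G(1)
          by (simp add: Y'_def abs_mult mult.assoc)
      qed
    qed
    from has_field_derivative_series[OF convex_real_interval(5) dY this c sY[OF c]]
    have "\<exists>h. \<forall>s\<in>{c..d}. (\<lambda>n. Y n s) sums h s \<and>
        (h has_real_derivative (\<Sum>i. Y' i s)) (at s within {c..d})"
      by blast
    then
    obtain h where h: "\<And>s. s \<in> {c..d} \<Longrightarrow> (\<lambda>n. Y n s) sums h s"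
      "\<And>s. s \<in> {c..d} \<Longrightarrow> (h has_real_derivative (\<Sum>i. Y' i s)) (at s within {c..d})"
      by blast
    have "(v has_real_derivative (\<Sum>i. Y' i t)) (at t within {c..d})"
      by (rule has_field_derivative_transform_within[OF h(2)[OF t], of 1])
        (use h(1) t in \<open>auto simp: v_def sums_iff\<close>)
    moreover have "(\<lambda>i. Y' i t) sums (g t * u t)"
      using sums_mult[OF summable_sums[OF sX[OF t]], of "g t"]
        sums_Suc[of "\<lambda>i. Y' i t" "g t * u t"]
      by (simp add: Y'_def u_def)
    ultimately show ?thesis by (simp add: sums_iff)
  qed
  have "Y n c = (if n = 0 then 1 else 0)" for n
    by (cases n) (simp_all add: Y0 YS)
  then have "v c = 1" using suminf_finite[of "{0}" "\<lambda>n. Y n c"] by (simp add: v_def)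
  moreover have "u c = 0" by (simp add: u_def X_def)
  ultimately show ?thesis using du dv unfolding sl_sol_def by blast
qed

section \<open>The solution of the initial value problem\<close>

text \<open>Principal eigenvalues. Both signs of \<open>l\<close> are admitted, and the interval is a parameter, because an
  arch of the nonlinear problem lives on a subinterval.\<close>
definition pos_sol ::
  "(real \<Rightarrow> real) \<Rightarrow> (real \<Rightarrow> real) \<Rightarrow> (real \<Rightarrow> real) \<Rightarrow> real \<Rightarrow> real \<Rightarrow> real \<Rightarrow> bool" where
  "pos_sol p q w c d l \<longleftrightarrow>
     (\<exists>u v. sl_sol p (\<lambda>t. q t - l * w t) c d u v \<and> u c = 0 \<and> u d = 0 \<and>
            (\<forall>t\<in>{c<..<d}. u t > 0))"

locale sl_problem =
  fixes p q w :: "real \<Rightarrow> real" and c d :: real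
  assumes cd: "c < d"
    and contp: "continuous_on {c..d} p" and contq: "continuous_on {c..d} q"
    and contw: "continuous_on {c..d} w"
    and pos_p: "\<And>t. t \<in> {c..d} \<Longrightarrow> p t > 0"
    and nonneg_q: "\<And>t. t \<in> {c..d} \<Longrightarrow> q t \<ge> 0"
begin

lemma cont_potential: "continuous_on {c..d} (\<lambda>t. q t - l * w t)"
  by (intro continuous_intros contq contw)

definition shot :: "real \<Rightarrow> (real \<Rightarrow> real) \<times> (real \<Rightarrow> real)" where
  "shot l = (SOME uv. sl_sol p (\<lambda>t. q t - l * w t) c d (fst uv) (snd uv) \<and>
                      fst uv c = 0 \<and> snd uv c = 1)"

definition U :: "real \<Rightarrow> real \<Rightarrow> real" where "U l = fst (shot l)"
definition V :: "real \<Rightarrow> real \<Rightarrow> real" where "V l = snd (shot l)"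

lemma shot: "sl_sol p (\<lambda>t. q t - l * w t) c d (U l) (V l)" "U l c = 0" "V l c = 1"
proof -
  have "\<exists>uv. sl_sol p (\<lambda>t. q t - l * w t) c d (fst uv) (snd uv) \<and> fst uv c = 0 \<and> snd uv c = 1"
    using sl_sol_exists[OF _ contp cont_potential pos_p, of l] cd by auto
  from someI_ex[OF this]
  show "sl_sol p (\<lambda>t. q t - l * w t) c d (U l) (V l)" "U l c = 0" "V l c = 1"
    unfolding U_def V_def shot_def by auto
qed

lemmas cont_U = sl_sol_cont(1)[OF shot(1)] and cont_V = sl_sol_cont(2)[OF shot(1)]

lemma sl_sol_zero:
  assumes "sl_sol p (\<lambda>t. q t - l * w t) a b u v" "c \<le> a" "b \<le> d"
    and "t0 \<in> {a..b}" "u t0 = 0" "v t0 = 0" "t \<in> {a..b}"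
  shows "u t = 0" "v t = 0"
proof -
  have "{a..b} \<subseteq> {c..d}" using assms by auto
  then have "u t = 0 \<and> v t = 0"
    using assms by (intro sl_sol_unique[of a b p "\<lambda>t. q t - l * w t" u v t0])
      (auto intro: continuous_on_subset[OF contp] continuous_on_subset[OF cont_potential] pos_p)
  then show "u t = 0" "v t = 0" by auto
qed

lemma shot_proportional:
  assumes sol: "sl_sol p (\<lambda>t. q t - l * w t) c e u v" and "u c = 0" "e \<le> d" "t \<in> {c..e}"
  shows "u t = v c * U l t" "v t = v c * V l t"
proof -
  have "sl_sol p (\<lambda>t. q t - l * w t) c e (U l) (V l)"
    using sl_sol_subinterval[OF shot(1)] assms by auto
  from sl_sol_combine[OF sol this, of 1 "- v c"]
  have *: "sl_sol p (\<lambda>t. q t - l * w t) c e (\<lambda>t. 1 * u t + - v c * U l t) (\<lambda>t. 1 * v t + - v c * V l t)" .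
  show "u t = v c * U l t" "v t = v c * V l t"
    using sl_sol_zero[OF *, of c t] assms by (auto simp: shot)
qed

lemma shot_zero_simple:
  assumes "U l z = 0" "z \<in> {c..d}"
  shows "V l z \<noteq> 0"
  using sl_sol_zero(2)[OF shot(1), of z l c] assms cd shot(3)[of l] by auto

lemma shot_pos_near_c:
  assumes "\<And>t. t \<in> {c..e} \<Longrightarrow> V l t > 0" "e \<le> d" "t \<in> {c<..e}"
  shows "U l t > 0"
proof -
  have "U l c < U l t"
  proof (rule DERIV_pos_imp_increasing_open[of c t "U l"])
    fix s assume s: "c < s" "s < t"
    then show "\<exists>y. (U l has_real_derivative y) (at s) \<and> y > 0"
      using sl_sol_deriv_at(1)[OF shot(1), of s l] assms(1)[of s] assms pos_p[of s]
      by (intro exI[of _ "V l s / p s"]) auto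
  qed (use assms in \<open>auto intro: continuous_on_subset[OF cont_U]\<close>)
  then show ?thesis by (simp add: shot)
qed

text \<open>The constant \<open>3 / 4\<close> is any number below \<open>V l c = 1\<close>; what matters is that the bound is positive.\<close>
lemma V_pos_near_c: "\<exists>\<eta>>c. \<eta> \<le> d \<and> (\<forall>t\<in>{c..\<eta>}. V l t > 3 / 4)"
proof -
  have "(V l \<longlongrightarrow> V l c) (at c within {c..d})"
    using cont_V[of l] cd by (simp add: continuous_on_def)
  then have "\<forall>\<^sub>F t in at c within {c..d}. V l t > 3 / 4"
    by (rule order_tendstoD) (simp add: shot)
  then obtain e where e: "e > 0" "\<forall>t\<in>{c..d}. t \<noteq> c \<and> dist t c < e \<longrightarrow> V l t > 3 / 4"
    unfolding eventually_at by auto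
  show ?thesis
  proof (intro exI[of _ "min d (c + e / 2)"] conjI ballI)
    fix t assume "t \<in> {c..min d (c + e / 2)}"
    then show "V l t > 3 / 4"
      using e(2)[rule_format, of t] e(1) by (cases "t = c") (auto simp: shot dist_real_def)
  qed (use e cd in auto)
qed

lemma shot_pos_start: "\<exists>\<eta>>c. \<eta> \<le> d \<and> (\<forall>t\<in>{c<..\<eta>}. U l t > 0)"
proof -
  obtain \<eta> where "\<eta> > c" "\<eta> \<le> d" "\<forall>t\<in>{c..\<eta>}. V l t > 3 / 4"
    using V_pos_near_c by blast
  then show ?thesis
    using shot_pos_near_c[of \<eta> l] by (intro exI[of _ \<eta>]) force
qed

lemma shot_pos_if_nonzero:
  assumes nz: "\<And>t. t \<in> {c<..<e} \<Longrightarrow> U l t \<noteq> 0" and "e \<le> d" and t: "t \<in> {c<..<e}"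
  shows "U l t > 0"
proof (rule ccontr)
  assume "\<not> U l t > 0"
  then have neg: "U l t < 0" using nz[OF t] by simp
  obtain \<eta> where \<eta>: "\<eta> > c" "\<forall>t\<in>{c<..\<eta>}. U l t > 0" using shot_pos_start by blast
  have "\<eta> < t" using neg \<eta> t by (meson greaterThanAtMost_iff greaterThanLessThan_iff not_less not_less_iff_gr_or_eq)
  moreover have "continuous_on {\<eta>..t} (U l)"
    using \<eta> t assms by (auto intro: continuous_on_subset[OF cont_U])
  ultimately obtain z where "\<eta> \<le> z" "z \<le> t" "U l z = 0"
    using IVT2'[of "U l" t 0 \<eta>] neg \<eta> by (force intro: less_imp_le)
  then show False using nz[of z] \<eta> t by auto
qed

text \<open>All solutions vanishing at \<open>c\<close> are multiples of \<open>U l\<close>, so principal eigenvalues of every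
  subinterval \<open>[c, e]\<close> can be read off from the single function \<open>U l\<close>.\<close>
lemma pos_sol_iff:
  assumes "c < e" "e \<le> d"
  shows "pos_sol p q w c e l \<longleftrightarrow> (\<forall>t\<in>{c<..<e}. U l t > 0) \<and> U l e = 0"
proof
  assume "pos_sol p q w c e l"
  then obtain u v where uv: "sl_sol p (\<lambda>t. q t - l * w t) c e u v" "u c = 0" "u e = 0"
    "\<forall>t\<in>{c<..<e}. u t > 0"
    unfolding pos_sol_def by auto
  note prp = shot_proportional(1)[OF uv(1,2) \<open>e \<le> d\<close>]
  have nz: "U l t \<noteq> 0" "v c \<noteq> 0" if "t \<in> {c<..<e}" for t
    using prp[of t] uv(4) that by force+
  have "v c \<noteq> 0" using nz(2)[of "(c + e) / 2"] \<open>c < e\<close> by auto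
  then have "U l e = 0" using prp[of e] uv(3) assms by auto
  then show "(\<forall>t\<in>{c<..<e}. U l t > 0) \<and> U l e = 0"
    using shot_pos_if_nonzero[OF nz(1) \<open>e \<le> d\<close>] by blast
next
  assume "(\<forall>t\<in>{c<..<e}. U l t > 0) \<and> U l e = 0"
  then show "pos_sol p q w c e l"
    unfolding pos_sol_def using sl_sol_subinterval[OF shot(1)[of l], of c e] assms
    by (intro exI[of _ "U l"] exI[of _ "V l"]) (auto simp: shot)
qed

text \<open>The difference \<open>(x, y)\<close> of two shots solves the system for \<open>l\<close> with the forcing term
  \<open>(l - \<mu>) w U \<mu>\<close>. Its energy starts at \<open>0\<close>, and Gronwall's inequality bounds it by a multiple of
  \<open>(l - \<mu>)\<^sup>2\<close>.\<close>
lemma shot_lipschitz: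
  "\<exists>C>0. \<forall>l t. \<bar>l - \<mu>\<bar> \<le> 1 \<longrightarrow> t \<in> {c..d} \<longrightarrow>
     \<bar>U l t - U \<mu> t\<bar> \<le> C * \<bar>l - \<mu>\<bar> \<and> \<bar>V l t - V \<mu> t\<bar> \<le> C * \<bar>l - \<mu>\<bar>"
proof -
  obtain K1 where K1: "K1 \<ge> 0" "\<And>t. t \<in> {c..d} \<Longrightarrow> \<bar>1 / p t + q t\<bar> \<le> K1"
    using energy_bound[OF contp contq pos_p] by blast
  obtain W where W: "W > 0" "\<And>t. t \<in> {c..d} \<Longrightarrow> \<bar>w t\<bar> \<le> W"
    using compact_imp_bounded[OF compact_continuous_image[OF contw compact_Icc]]
    unfolding bounded_pos by auto
  have "continuous_on {c..d} (\<lambda>t. w t * U \<mu> t)"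
    by (intro continuous_intros contw cont_U)
  from compact_imp_bounded[OF compact_continuous_image[OF this compact_Icc]]
  obtain M where M: "M > 0" "\<And>t. t \<in> {c..d} \<Longrightarrow> \<bar>w t * U \<mu> t\<bar> \<le> M"
    unfolding bounded_pos by auto
  define K where "K = K1 + (\<bar>\<mu>\<bar> + 1) * W"
  have K: "K \<ge> 0" using K1 W by (simp add: K_def)
  define C where "C = M * sqrt ((d - c) * exp ((K + 1) * (d - c)))"
  have C: "C > 0" using M cd by (simp add: C_def)
  have "\<bar>U l t - U \<mu> t\<bar> \<le> C * \<bar>l - \<mu>\<bar> \<and> \<bar>V l t - V \<mu> t\<bar> \<le> C * \<bar>l - \<mu>\<bar>"
    if l: "\<bar>l - \<mu>\<bar> \<le> 1" and t: "t \<in> {c..d}" for l t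
  proof -
    define x where "x = (\<lambda>t. U l t - U \<mu> t)"
    define y where "y = (\<lambda>t. V l t - V \<mu> t)"
    define E where "E = (\<lambda>t. (x t)\<^sup>2 + (y t)\<^sup>2)"
    define E' where "E' = (\<lambda>t. 2 * (x t * y t) * (1 / p t + q t - l * w t)
                               - 2 * y t * ((l - \<mu>) * (w t * U \<mu> t)))"
    have dx: "(x has_real_derivative y s / p s) (at s within {c..d})"
      and dy: "(y has_real_derivative (q s - l * w s) * x s - (l - \<mu>) * (w s * U \<mu> s))
                (at s within {c..d})" if "s \<in> {c..d}" for s
    proof -
      have "(U l has_real_derivative V l s / p s) (at s within {c..d})"
        "(U \<mu> has_real_derivative V \<mu> s / p s) (at s within {c..d})"
        "(V l has_real_derivative (q s - l * w s) * U l s) (at s within {c..d})"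
        "(V \<mu> has_real_derivative (q s - \<mu> * w s) * U \<mu> s) (at s within {c..d})"
        using shot(1)[of l] shot(1)[of \<mu>] that unfolding sl_sol_def by auto
      note D = this
      show "(x has_real_derivative y s / p s) (at s within {c..d})"
        unfolding x_def y_def using DERIV_diff[OF D(1,2)] by (simp add: diff_divide_distrib)
      have eq: "(q s - l * w s) * x s - (l - \<mu>) * (w s * U \<mu> s)
            = (q s - l * w s) * U l s - (q s - \<mu> * w s) * U \<mu> s"
        by (simp add: x_def algebra_simps)
      show "(y has_real_derivative (q s - l * w s) * x s - (l - \<mu>) * (w s * U \<mu> s)) (at s within {c..d})"
        unfolding eq unfolding y_def by (rule DERIV_diff[OF D(3,4)])
    qed
    have E: "(E has_real_derivative E' s) (at s within {c..d})" if "s \<in> {c..d}" for s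
      unfolding E_def E'_def
      by (auto intro!: derivative_eq_intros dx[OF that] dy[OF that] simp: algebra_simps)
    have le: "E' s \<le> (K + 1) * E s + ((l - \<mu>) * M)\<^sup>2" if s: "s \<in> {c..d}" for s
    proof -
      have "\<bar>1 / p s + q s - l * w s\<bar> \<le> \<bar>1 / p s + q s\<bar> + \<bar>l\<bar> * \<bar>w s\<bar>"
        using abs_triangle_ineq4[of "1 / p s + q s" "l * w s"] by (simp add: abs_mult)
      also have "\<bar>l\<bar> * \<bar>w s\<bar> \<le> (\<bar>\<mu>\<bar> + 1) * W"
        using l W(2)[OF s] W(1) by (intro mult_mono) auto
      finally have b1: "\<bar>1 / p s + q s - l * w s\<bar> \<le> K" using K1(2)[OF s] by (simp add: K_def)
      have "\<bar>2 * (x s * y s)\<bar> \<le> E s"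
        using sum_squares_bound[of "x s" "y s"] sum_squares_bound[of "x s" "- y s"]
        by (auto simp: E_def abs_le_iff)
      then have "\<bar>2 * (x s * y s)\<bar> * \<bar>1 / p s + q s - l * w s\<bar> \<le> E s * K"
        using b1 K by (intro mult_mono) (auto simp: E_def)
      then have a: "2 * (x s * y s) * (1 / p s + q s - l * w s) \<le> K * E s"
        by (metis abs_le_D1 abs_mult mult.commute)
      have "- 2 * y s * ((l - \<mu>) * (w s * U \<mu> s)) \<le> (y s)\<^sup>2 + ((l - \<mu>) * (w s * U \<mu> s))\<^sup>2"
        using sum_squares_bound[of "- y s" "(l - \<mu>) * (w s * U \<mu> s)"] by simp
      also have "\<dots> \<le> E s + ((l - \<mu>) * M)\<^sup>2"
      proof (rule add_mono)
        show "((l - \<mu>) * (w s * U \<mu> s))\<^sup>2 \<le> ((l - \<mu>) * M)\<^sup>2"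
          using M(2)[OF s] M(1) by (intro abs_le_square_iff[THEN iffD1]) (auto simp: abs_mult intro: mult_left_mono)
      qed (simp add: E_def)
      finally show ?thesis using a by (simp add: E'_def algebra_simps)
    qed
    have "E t \<le> (E c + ((l - \<mu>) * M)\<^sup>2 * (t - c)) * exp ((K + 1) * (t - c))"
      by (rule gronwall_forward[OF E le _ _ t]) (use K in auto)
    also have "\<dots> = ((l - \<mu>) * M)\<^sup>2 * ((t - c) * exp ((K + 1) * (t - c)))"
      by (simp add: E_def x_def y_def shot)
    also have "\<dots> \<le> ((l - \<mu>) * M)\<^sup>2 * ((d - c) * exp ((K + 1) * (d - c)))"
      using t K by (intro mult_left_mono mult_mono) (auto intro: mult_left_mono)
    also have "\<dots> = (C * \<bar>l - \<mu>\<bar>)\<^sup>2"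
      using cd by (simp add: C_def power_mult_distrib real_sqrt_pow2)
    finally have "(x t)\<^sup>2 \<le> (C * \<bar>l - \<mu>\<bar>)\<^sup>2" "(y t)\<^sup>2 \<le> (C * \<bar>l - \<mu>\<bar>)\<^sup>2"
      using zero_le_power2[of "x t"] zero_le_power2[of "y t"] unfolding E_def by linarith+
    then show ?thesis
      using C abs_le_square_iff[of "x t" "C * \<bar>l - \<mu>\<bar>"] abs_le_square_iff[of "y t" "C * \<bar>l - \<mu>\<bar>"]
      by (simp add: x_def y_def abs_mult)
  qed
  then show ?thesis using C by blast
qed

text \<open>Uniform closeness alone does not give positivity near \<open>c\<close>, where \<open>U \<mu>\<close> vanishes. There
  the momentum \<open>V\<close>, which stays close to \<open>V \<mu> c = 1\<close>, forces \<open>U l\<close> to increase.\<close>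
lemma shot_pos_stable:
  assumes pos: "\<And>t. t \<in> {c<..e} \<Longrightarrow> U \<mu> t > 0" and e: "c < e" "e \<le> d"
  shows "\<exists>\<delta>>0. \<forall>l. \<bar>l - \<mu>\<bar> < \<delta> \<longrightarrow> (\<forall>t\<in>{c<..e}. U l t > 0)"
proof -
  obtain C where C: "C > 0" "\<And>l t. \<bar>l - \<mu>\<bar> \<le> 1 \<Longrightarrow> t \<in> {c..d} \<Longrightarrow>
     \<bar>U l t - U \<mu> t\<bar> \<le> C * \<bar>l - \<mu>\<bar> \<and> \<bar>V l t - V \<mu> t\<bar> \<le> C * \<bar>l - \<mu>\<bar>"
    using shot_lipschitz[of \<mu>] by blast
  obtain \<eta> where \<eta>: "\<eta> > c" "\<eta> \<le> d" "\<forall>t\<in>{c..\<eta>}. V \<mu> t > 3 / 4"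
    using V_pos_near_c by blast
  define s where "s = min \<eta> e"
  have s: "c < s" "s \<le> e" "s \<le> \<eta>" using \<eta> e by (auto simp: s_def)
  obtain z where z: "z \<in> {s..e}" "\<And>t. t \<in> {s..e} \<Longrightarrow> U \<mu> z \<le> U \<mu> t"
    using continuous_attains_inf[of "{s..e}" "U \<mu>"] s e
      continuous_on_subset[OF cont_U[of \<mu>], of "{s..e}"] by auto
  define \<kappa> where "\<kappa> = min (3 / 4) (U \<mu> z)"
  have \<kappa>: "\<kappa> > 0" using pos[of z] z(1) s by (auto simp: \<kappa>_def)
  have "\<forall>t\<in>{c<..e}. U l t > 0" if l: "\<bar>l - \<mu>\<bar> < min 1 (\<kappa> / C)" for l
  proof
    have small: "C * \<bar>l - \<mu>\<bar> < \<kappa>" "\<bar>l - \<mu>\<bar> \<le> 1"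
      using l C(1) by (auto simp: field_simps)
    fix t assume t: "t \<in> {c<..e}"
    show "U l t > 0"
    proof (cases "t \<le> s")
      case True
      have "V l r > 0" if "r \<in> {c..s}" for r
        using C(2)[OF small(2), of r] small(1) that s \<eta> e by (force simp: \<kappa>_def)
      then show ?thesis using shot_pos_near_c[of s l t] True t s e by auto
    next
      case False
      then show ?thesis
        using C(2)[OF small(2), of t] small(1) z(2)[of t] t s e by (force simp: \<kappa>_def)
    qed
  qed
  then show ?thesis using \<kappa> C(1) by (intro exI[of _ "min 1 (\<kappa> / C)"]) auto
qed

lemma shot_neg_stable:
  assumes "U \<mu> t < 0" "t \<in> {c..d}"
  shows "\<exists>\<delta>>0. \<forall>l. \<bar>l - \<mu>\<bar> < \<delta> \<longrightarrow> U l t < 0"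
proof -
  obtain C where C: "C > 0" "\<And>l t. \<bar>l - \<mu>\<bar> \<le> 1 \<Longrightarrow> t \<in> {c..d} \<Longrightarrow>
     \<bar>U l t - U \<mu> t\<bar> \<le> C * \<bar>l - \<mu>\<bar> \<and> \<bar>V l t - V \<mu> t\<bar> \<le> C * \<bar>l - \<mu>\<bar>"
    using shot_lipschitz[of \<mu>] by blast
  have "U l t < 0" if l: "\<bar>l - \<mu>\<bar> < min 1 (- U \<mu> t / C)" for l
  proof -
    have "C * \<bar>l - \<mu>\<bar> < - U \<mu> t" "\<bar>l - \<mu>\<bar> \<le> 1"
      using l C(1) by (auto simp: field_simps)
    then show ?thesis using C(2)[of l t] assms by force
  qed
  then show ?thesis using assms C(1)
    by (intro exI[of _ "min 1 (- U \<mu> t / C)"]) (auto intro: divide_neg_pos)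
qed

text \<open>By uniqueness a zero is simple.\<close>
lemma shot_changes_sign:
  assumes z: "U l z = 0" "c < z" "z < d"
  shows "\<exists>t\<in>{c<..<d}. U l t < 0"
proof -
  have D: "(U l has_real_derivative V l z / p z) (at z)"
    using sl_sol_deriv_at(1)[OF shot(1)] z by auto
  have "p z > 0" "V l z \<noteq> 0" using pos_p[of z] shot_zero_simple[of l z] z by auto
  then consider "V l z / p z > 0" | "V l z / p z < 0"
    by (metis divide_eq_0_iff less_irrefl linorder_neqE_linordered_idom)
  then show ?thesis
  proof cases
    case 1
    from DERIV_pos_inc_left[OF D this] obtain r where r: "r > 0" "\<forall>h>0. h < r \<longrightarrow> U l (z - h) < U l z"
      by blast
    define h where "h = min (r / 2) ((z - c) / 2)"
    have h: "h > 0" "h < r" using r z by (auto simp: h_def min_less_iff_disj)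
    have h': "h \<le> (z - c) / 2" unfolding h_def by (rule min.cobounded2)
    from h have "U l (z - h) < 0" using r(2) z(1) by auto
    then show ?thesis using h h' z by (intro bexI[of _ "z - h"]) (auto simp: field_simps)
  next
    case 2
    from DERIV_neg_dec_right[OF D this] obtain r where r: "r > 0" "\<forall>h>0. h < r \<longrightarrow> U l (z + h) < U l z"
      by blast
    define h where "h = min (r / 2) ((d - z) / 2)"
    have h: "h > 0" "h < r" using r z by (auto simp: h_def min_less_iff_disj)
    have h': "h \<le> (d - z) / 2" unfolding h_def by (rule min.cobounded2)
    from h have "U l (z + h) < 0" using r(2) z(1) by auto
    then show ?thesis using h h' z by (intro bexI[of _ "z + h"]) (auto simp: field_simps)
  qed
qed

lemma shot_trichotomy:
  "(\<forall>t\<in>{c<..d}. U l t > 0) \<or> (\<exists>t\<in>{c<..<d}. U l t < 0) \<or> pos_sol p q w c d l"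
proof (cases "\<exists>t\<in>{c<..<d}. U l t = 0")
  case True
  then show ?thesis using shot_changes_sign by auto
next
  case False
  then have pos: "U l t > 0" if "t \<in> {c<..<d}" for t
    using shot_pos_if_nonzero[of d l t] that by auto
  have "\<exists>t\<in>{c<..<d}. U l t < 0" if neg: "U l d < 0"
  proof -
    have "U l ((c + d) / 2) > 0" using pos cd by (auto simp: field_simps)
    then obtain z where "(c + d) / 2 \<le> z" "z \<le> d" "U l z = 0"
      using IVT2'[of "U l" d 0 "(c + d) / 2"] neg cd
        continuous_on_subset[OF cont_U[of l], of "{(c + d) / 2..d}"] by (force simp: field_simps)
    moreover have "z \<noteq> d" "(c + d) / 2 > c" using neg \<open>U l z = 0\<close> cd by auto
    ultimately show ?thesis using False by auto
  qed
  moreover have "\<forall>t\<in>{c<..d}. U l t > 0" if "U l d > 0"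
    using pos that by (metis greaterThanAtMost_iff greaterThanLessThan_iff less_eq_real_def)
  ultimately show ?thesis
    using pos_sol_iff[of d l] pos cd by (meson less_linear order_refl)
qed

text \<open>For \<open>l = 0\<close> one has \<open>(u v)' = v\<^sup>2 / p + q u\<^sup>2 \<ge> 0\<close>, so \<open>u v \<ge> 0\<close> and \<open>u\<^sup>2\<close> is
  nondecreasing.\<close>
lemma shot_0_pos: "t \<in> {c<..d} \<Longrightarrow> U 0 t > 0"
proof -
  assume t: "t \<in> {c<..d}"
  have mono: "(U 0 a)\<^sup>2 \<le> (U 0 b)\<^sup>2" if "c \<le> a" "a \<le> b" "b \<le> d" for a b
  proof -
    have UV: "U 0 r * V 0 r \<ge> 0" if r: "r \<in> {c..d}" for r
    proof -
      have "U 0 c * V 0 c \<le> U 0 r * V 0 r"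
      proof (rule DERIV_nonneg_imp_increasing_open[of c r "\<lambda>r. U 0 r * V 0 r"])
        fix s assume s: "c < s" "s < r"
        then have "p s > 0" "q s \<ge> 0" using r pos_p nonneg_q by auto
        then show "\<exists>y. ((\<lambda>r. U 0 r * V 0 r) has_real_derivative y) (at s) \<and> y \<ge> 0"
          using DERIV_mult[OF sl_sol_deriv_at[OF shot(1)[of 0]], of s] s r
          by (intro exI[of _ "V 0 s / p s * V 0 s + (q s - 0 * w s) * U 0 s * U 0 s"]) (auto simp: mult.assoc)
      qed (use r in \<open>auto intro!: continuous_intros continuous_on_subset[OF cont_U] continuous_on_subset[OF cont_V]\<close>)
      then show ?thesis by (simp add: shot)
    qed
    show ?thesis
    proof (rule DERIV_nonneg_imp_increasing_open[of a b "\<lambda>r. (U 0 r)\<^sup>2"])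
      fix s assume s: "a < s" "s < b"
      then have "p s > 0" "U 0 s * V 0 s \<ge> 0" using that pos_p UV by auto
      then show "\<exists>y. ((\<lambda>r. (U 0 r)\<^sup>2) has_real_derivative y) (at s) \<and> y \<ge> 0"
        using sl_sol_deriv_at(1)[OF shot(1)[of 0], of s] s that
        by (intro exI[of _ "2 * (U 0 s * V 0 s) / p s"]) (auto intro!: derivative_eq_intros)
    qed (use that in \<open>auto intro!: continuous_intros continuous_on_subset[OF cont_U]\<close>)
  qed
  obtain \<eta> where \<eta>: "\<eta> > c" "\<eta> \<le> d" "\<forall>t\<in>{c<..\<eta>}. U 0 t > 0" using shot_pos_start by blast
  have nz: "U 0 t \<noteq> 0" if t: "t \<in> {c<..d}" for t
  proof (cases "t \<le> \<eta>")
    case True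
    then have "U 0 t > 0" using \<eta>(3) t by simp
    then show ?thesis by simp
  next
    case False
    have "U 0 \<eta> > 0" using \<eta> by simp
    then have "(U 0 \<eta>)\<^sup>2 > 0" by simp
    also have "(U 0 \<eta>)\<^sup>2 \<le> (U 0 t)\<^sup>2" using False \<eta> t by (intro mono) auto
    finally show ?thesis by simp
  qed
  show "U 0 t > 0"
  proof (cases "t = d")
    case True
    have "\<not> pos_sol p q w c d 0" using nz[of d] pos_sol_iff[of d 0] cd by auto
    moreover have "\<not> (\<exists>t\<in>{c<..<d}. U 0 t < 0)"
      using shot_pos_if_nonzero[of d 0] nz by (metis greaterThanAtMost_iff greaterThanLessThan_iff less_imp_le not_less_iff_gr_or_eq order_refl)
    ultimately show ?thesis using shot_trichotomy[of 0] t by auto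
  qed (use shot_pos_if_nonzero[of d 0 t] nz t in auto)
qed

text \<open>The parameters with \<open>U l\<close> positive on \<open>(c, d]\<close> and those with a negative value of \<open>U l\<close> form
  disjoint open sets that contain \<open>0\<close> and \<open>\<Lambda>\<close>; they cannot cover the connected set \<open>[0, \<Lambda>]\<close>, and by
  trichotomy every parameter missed is a principal eigenvalue.\<close>
lemma shot_neg_imp_pos_sol:
  assumes "\<Lambda> > 0" and neg: "t \<in> {c<..<d}" "U \<Lambda> t < 0"
  shows "\<exists>\<beta>. 0 < \<beta> \<and> \<beta> < \<Lambda> \<and> pos_sol p q w c d \<beta>"
proof (rule ccontr)
  assume no: "\<not> ?thesis"
  define A where "A = {l. \<forall>t\<in>{c<..d}. U l t > 0}"
  define B where "B = {l. \<exists>t\<in>{c<..<d}. U l t < 0}"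
  have "open A" unfolding open_dist
  proof
    fix \<mu> assume "\<mu> \<in> A"
    then show "\<exists>e>0. \<forall>y. dist y \<mu> < e \<longrightarrow> y \<in> A"
      using shot_pos_stable[of d \<mu>] cd by (auto simp: A_def dist_real_def)
  qed
  moreover have "open B" unfolding open_dist
  proof
    fix \<mu> assume "\<mu> \<in> B"
    then obtain t where t: "t \<in> {c<..<d}" "U \<mu> t < 0" by (auto simp: B_def)
    then show "\<exists>e>0. \<forall>y. dist y \<mu> < e \<longrightarrow> y \<in> B"
      using shot_neg_stable[of \<mu> t] unfolding B_def dist_real_def
      by (metis (mono_tags, lifting) atLeastAtMost_iff greaterThanLessThan_iff less_imp_le mem_Collect_eq)
  qed
  moreover have "A \<inter> B \<inter> {0..\<Lambda>} = {}"
  proof -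
    have "l \<notin> B" if "l \<in> A" for l using that unfolding A_def B_def by force
    then show ?thesis by blast
  qed
  moreover have A0: "0 \<in> A" using shot_0_pos by (auto simp: A_def)
  moreover have B\<Lambda>: "\<Lambda> \<in> B" using neg by (auto simp: B_def)
  moreover have "{0..\<Lambda>} \<subseteq> A \<union> B"
  proof
    fix l assume l: "l \<in> {0..\<Lambda>}"
    show "l \<in> A \<union> B"
    proof (cases "l = 0 \<or> l = \<Lambda>")
      case False
      then show ?thesis using no shot_trichotomy[of l] l by (auto simp: A_def B_def)
    qed (use A0 B\<Lambda> in auto)
  qed
  ultimately show False
    using connectedD[of "{0..\<Lambda>}" A B] assms(1) by force
qed

end

section \<open>Comparison and oscillation\<close>

text \<open>Picone's identity. Of the terms on the right only the subtracted square involves \<open>u\<close>, so dropping it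
  yields an inequality in \<open>\<phi>\<close> alone.\<close>
lemma picone_deriv:
  assumes "sl_sol p g a b u v" "s \<in> {a<..<b}" "u s \<noteq> 0" "p s \<noteq> 0"
    and \<phi>: "(\<phi> has_real_derivative \<phi>') (at s)"
  shows "((\<lambda>s. (\<phi> s)\<^sup>2 * v s / u s) has_real_derivative
           p s * \<phi>'\<^sup>2 + g s * (\<phi> s)\<^sup>2 - p s * (\<phi>' - \<phi> s * v s / (p s * u s))\<^sup>2) (at s)"
proof -
  have D: "(u has_real_derivative v s / p s) (at s)" "(v has_real_derivative g s * u s) (at s)"
    using sl_sol_deriv_at[OF assms(1)] assms(2) by auto
  show ?thesis
    by (rule derivative_eq_intros D \<phi> refl | fact)+
      (use assms(3,4) in \<open>simp add: field_simps power2_eq_square\<close>)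
qed

text \<open>Continuity of the Picone function at an end point where both solutions vanish: there \<open>f / g\<close> stays
  bounded and \<open>f\<close> tends to \<open>0\<close>.\<close>
lemma square_over_tendsto_0:
  fixes f g :: "real \<Rightarrow> real"
  assumes f: "(f has_real_derivative f') (at x within S)" "f x = 0"
    and g: "(g has_real_derivative g') (at x within S)" "g x = 0" "g' \<noteq> 0"
  shows "((\<lambda>s. (f s)\<^sup>2 / g s) \<longlongrightarrow> 0) (at x within S)"
proof -
  have "(f \<longlongrightarrow> 0) (at x within S)"
    using has_field_derivative_imp_has_derivative[OF f(1)] has_derivative_continuous f(2)
    unfolding continuous_within by force
  then have "((\<lambda>s. f s * ((f s - f x) / (s - x)) / ((g s - g x) / (s - x))) \<longlongrightarrow> 0 * f' / g') (at x within S)"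
    using f g by (intro tendsto_intros) (auto simp: has_field_derivative_iff)
  then have "((\<lambda>s. f s * ((f s - f x) / (s - x)) / ((g s - g x) / (s - x))) \<longlongrightarrow> 0) (at x within S)"
    by simp
  then show ?thesis
    by (rule Lim_transform_eventually)
      (auto simp: f g eventually_at_filter power2_eq_square)
qed

context sl_problem
begin

lemma shot_first_zero:
  assumes "U l z \<le> 0" "c < z" "z \<le> d"
  shows "\<exists>z0\<in>{c<..z}. U l z0 = 0 \<and> (\<forall>t\<in>{c<..<z0}. U l t > 0)"
proof -
  obtain \<eta> where \<eta>: "\<eta> > c" "\<forall>t\<in>{c<..\<eta>}. U l t > 0" using shot_pos_start by blast
  have "\<eta> < z"
  proof (rule ccontr)
    assume "\<not> \<eta> < z"
    then have "U l z > 0" using \<eta> assms by auto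
    then show False using assms by simp
  qed
  have cont: "continuous_on {\<eta>..z} (U l)"
    using \<eta> assms by (auto intro: continuous_on_subset[OF cont_U])
  have "U l \<eta> > 0" using \<eta> by simp
  then obtain z1 where z1: "\<eta> \<le> z1" "z1 \<le> z" "U l z1 = 0"
    using IVT2'[of "U l" z 0 \<eta>] \<open>\<eta> < z\<close> cont assms by force
  have "closed {t \<in> {\<eta>..z}. U l t = 0}"
    using continuous_closed_preimage_constant[OF cont] by simp
  moreover have "bounded {t \<in> {\<eta>..z}. U l t = 0}"
    by (rule bounded_subset[OF bounded_closed_interval[of \<eta> z]]) auto
  ultimately have "compact {t \<in> {\<eta>..z}. U l t = 0}"
    by (simp add: compact_eq_bounded_closed)
  then obtain z0 where z0: "z0 \<in> {t \<in> {\<eta>..z}. U l t = 0}"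
    "\<And>t. t \<in> {t \<in> {\<eta>..z}. U l t = 0} \<Longrightarrow> z0 \<le> t"
    using compact_attains_inf[of "{t \<in> {\<eta>..z}. U l t = 0}"] z1 by auto
  have "U l t \<noteq> 0" if t: "t \<in> {c<..<z0}" for t
  proof (cases "t \<le> \<eta>")
    case True
    then have "U l t > 0" using \<eta> t by simp
    then show ?thesis by simp
  next
    case False
    then show ?thesis using z0(2)[of t] z0(1) t by force
  qed
  moreover have "z0 \<le> d" using z0(1) assms by auto
  ultimately have "\<forall>t\<in>{c<..<z0}. U l t > 0" using shot_pos_if_nonzero by blast
  then show ?thesis using z0(1) \<eta> by (intro bexI[of _ z0]) auto
qed

text \<open>Suppose that \<open>\<phi> = U l\<close> has a first zero \<open>z\<close>, and let \<open>u = U \<mu>\<close>. Multiplying the energy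
  identity \<open>(\<phi> p \<phi>')' = p \<phi>'\<^sup>2 + (q - l w) \<phi>\<^sup>2\<close> by \<open>\<mu> / l\<close> and subtracting Picone's identity
  for \<open>\<phi>\<close> and \<open>u\<close> cancels the weight, whatever its sign: \<open>F = (\<mu> / l) \<phi> p \<phi>' - \<phi>\<^sup>2 p u' / u\<close>
  is nondecreasing on \<open>[c, z]\<close> and strictly increasing near \<open>c\<close>, where \<open>\<phi>' \<noteq> 0\<close>. But
  \<open>F\<close> vanishes at both ends.\<close>
lemma shot_pos_below:
  assumes lm: "0 < l" "l < \<mu>" and e: "c < e" "e \<le> d"
    and pos: "\<And>t. t \<in> {c<..<e} \<Longrightarrow> U \<mu> t > 0" and t: "t \<in> {c<..e}"
  shows "U l t > 0"
proof (rule ccontr)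
  assume "\<not> U l t > 0"
  then obtain z where z: "z \<in> {c<..t}" "U l z = 0" "\<And>s. s \<in> {c<..<z} \<Longrightarrow> U l s > 0"
    using shot_first_zero[of l t] t e by (force simp: not_less)
  have zd: "c < z" "z \<le> e" "z \<le> d" using z t e by auto
  define F where "F = (\<lambda>s. \<mu> / l * (U l s * V l s) - (U l s)\<^sup>2 * V \<mu> s / U \<mu> s)"
  define F' where "F' = (\<lambda>s. (\<mu> / l - 1) * ((V l s)\<^sup>2 / p s + q s * (U l s)\<^sup>2)
      + p s * (V l s / p s - U l s * V \<mu> s / (p s * U \<mu> s))\<^sup>2)"
  have dF: "(F has_real_derivative F' s) (at s)" if s: "s \<in> {c<..<z}" for s
  proof -
    have ps: "p s > 0" and u0: "U \<mu> s > 0" using pos_p[of s] pos[of s] s zd by auto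
    have sd: "c < s" "s < d" using s zd by auto
    note D = sl_sol_deriv_at[OF shot(1)[of l] sd]
    note P = picone_deriv[OF shot(1)[of \<mu>], of s, OF _ _ _ D(1)]
    have eq: "F' s = \<mu> / l * (V l s / p s * V l s + (q s - l * w s) * U l s * U l s)
        - (p s * (V l s / p s)\<^sup>2 + (q s - \<mu> * w s) * (U l s)\<^sup>2
           - p s * (V l s / p s - U l s * V \<mu> s / (p s * U \<mu> s))\<^sup>2)"
    proof -
      have "\<mu> / l * (V l s / p s * V l s + (q s - l * w s) * U l s * U l s)
        - (p s * (V l s / p s)\<^sup>2 + (q s - \<mu> * w s) * (U l s)\<^sup>2)
        = (\<mu> / l - 1) * ((V l s)\<^sup>2 / p s + q s * (U l s)\<^sup>2)"
        using lm ps by (simp add: field_simps power2_eq_square)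
      then show ?thesis unfolding F'_def by linarith
    qed
    have 1: "((\<lambda>s. \<mu> / l * (U l s * V l s)) has_real_derivative
        \<mu> / l * (V l s / p s * V l s + (q s - l * w s) * U l s * U l s)) (at s)"
      by (rule DERIV_cmult[OF DERIV_mult[OF D]])
    have 2: "((\<lambda>s. (U l s)\<^sup>2 * V \<mu> s / U \<mu> s) has_real_derivative
        p s * (V l s / p s)\<^sup>2 + (q s - \<mu> * w s) * (U l s)\<^sup>2
           - p s * (V l s / p s - U l s * V \<mu> s / (p s * U \<mu> s))\<^sup>2) (at s)"
      using P sd ps u0 by auto
    show ?thesis unfolding eq unfolding F_def by (rule DERIV_diff[OF 1 2])
  qed
  have F'_ge: "F' s \<ge> (\<mu> / l - 1) * ((V l s)\<^sup>2 / p s)" if s: "s \<in> {c<..<z}" for s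
  proof -
    have "p s > 0" "q s \<ge> 0" using pos_p[of s] nonneg_q[of s] s zd by auto
    then have "(\<mu> / l - 1) * (q s * (U l s)\<^sup>2) \<ge> 0"
      "p s * (V l s / p s - U l s * V \<mu> s / (p s * U \<mu> s))\<^sup>2 \<ge> 0"
      using lm by simp_all
    then show ?thesis by (simp add: F'_def distrib_left)
  qed
  have F_end: "F c = 0" "F z = 0" using z by (simp_all add: F_def shot)
  have ratio: "((\<lambda>s. (U l s)\<^sup>2 * V \<mu> s / U \<mu> s) \<longlongrightarrow> (U l x)\<^sup>2 * V \<mu> x / U \<mu> x) (at x within {c..z})"
    if x: "x \<in> {c..z}" for x
  proof (cases "U \<mu> x = 0")
    case False
    have sub: "{c..z} \<subseteq> {c..d}" using zd by auto
    have "(U l \<longlongrightarrow> U l x) (at x within {c..z})" "(U \<mu> \<longlongrightarrow> U \<mu> x) (at x within {c..z})"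
      "(V \<mu> \<longlongrightarrow> V \<mu> x) (at x within {c..z})"
      using x continuous_on_subset[OF cont_U[of l] sub] continuous_on_subset[OF cont_U[of \<mu>] sub]
        continuous_on_subset[OF cont_V[of \<mu>] sub] unfolding continuous_on_def by blast+
    then show ?thesis using False by (intro tendsto_intros)
  next
    case True
    have sub: "{c..z} \<subseteq> {c..d}" using zd by auto
    have "x = c \<or> x = z" using pos[of x] True x zd by force
    then have "U l x = 0" using z(2) by (auto simp: shot)
    moreover have "(U l has_real_derivative V l x / p x) (at x within {c..z})"
      "(U \<mu> has_real_derivative V \<mu> x / p x) (at x within {c..z})"
      using shot(1)[of l] shot(1)[of \<mu>] x sub unfolding sl_sol_def by (blast intro: DERIV_subset)+
    moreover have "V \<mu> x / p x \<noteq> 0"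
      using shot_zero_simple[OF True] pos_p[of x] x zd by force
    ultimately have "((\<lambda>s. (U l s)\<^sup>2 / U \<mu> s) \<longlongrightarrow> 0) (at x within {c..z})"
      using True by (intro square_over_tendsto_0)
    moreover have "(V \<mu> \<longlongrightarrow> V \<mu> x) (at x within {c..z})"
      using x continuous_on_subset[OF cont_V[of \<mu>] sub] unfolding continuous_on_def by blast
    ultimately have "((\<lambda>s. (U l s)\<^sup>2 / U \<mu> s * V \<mu> s) \<longlongrightarrow> 0 * V \<mu> x) (at x within {c..z})"
      by (rule tendsto_mult)
    then show ?thesis using True by (simp add: mult.commute)
  qed
  have contF: "continuous_on {c..z} F"
  proof -
    have "continuous_on {c..z} (\<lambda>s. (U l s)\<^sup>2 * V \<mu> s / U \<mu> s)"
      unfolding continuous_on_def using ratio by blast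
    moreover have "continuous_on {c..z} (\<lambda>s. \<mu> / l * (U l s * V l s))"
      using zd by (intro continuous_intros continuous_on_subset[OF cont_U] continuous_on_subset[OF cont_V]) auto
    ultimately show ?thesis unfolding F_def by (rule continuous_on_diff[rotated])
  qed
  obtain \<eta> where \<eta>: "\<eta> > c" "\<forall>t\<in>{c..\<eta>}. V l t > 3 / 4" using V_pos_near_c by blast
  define b where "b = min \<eta> z"
  have b: "c < b" "b \<le> z" "b \<le> \<eta>" using \<eta> zd by (auto simp: b_def)
  have "F c < F b"
  proof (rule DERIV_pos_imp_increasing_open[of c b F])
    fix s assume s: "c < s" "s < b"
    have "V l s > 3 / 4" "p s > 0" using \<eta> b s pos_p[of s] zd by auto
    then have "(\<mu> / l - 1) * ((V l s)\<^sup>2 / p s) > 0" using lm by (intro mult_pos_pos) auto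
    then show "\<exists>y. (F has_real_derivative y) (at s) \<and> y > 0"
      using dF[of s] F'_ge[of s] s b by (intro exI[of _ "F' s"]) auto
  qed (use b contF in \<open>auto intro: continuous_on_subset\<close>)
  moreover have "F b \<le> F z"
  proof (rule DERIV_nonneg_imp_increasing_open[of b z F])
    fix s assume s: "b < s" "s < z"
    have "p s > 0" using b s pos_p[of s] zd by auto
    then have "(\<mu> / l - 1) * ((V l s)\<^sup>2 / p s) \<ge> 0" using lm by (intro mult_nonneg_nonneg) auto
    then show "\<exists>y. (F has_real_derivative y) (at s) \<and> y \<ge> 0"
      using dF[of s] F'_ge[of s] s b by (intro exI[of _ "F' s"]) auto
  qed (use b contF in \<open>auto intro: continuous_on_subset\<close>)
  ultimately show False using F_end by simp
qed

text \<open>Picone's identity with the test function \<open>\<phi> s = sin (k (s - r))\<close> supported on an interval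
  \<open>[r, b]\<close> where \<open>w \<ge> w r / 2\<close>. The parameter \<open>\<Lambda>\<close> is chosen such that
  \<open>q - \<Lambda> w \<le> - P k\<^sup>2 - 1\<close> there. The term subtracted in \<open>G\<close> is a primitive of
  \<open>P k\<^sup>2 cos (2 k (s - r))\<close> that vanishes at both ends.\<close>
lemma shot_oscillates:
  assumes r: "r \<in> {c<..<d}" "w r > 0"
  shows "\<exists>\<Lambda>>0. \<exists>t\<in>{c<..<d}. U \<Lambda> t < 0"
proof -
  have "isCont w r"
    using contw r continuous_on_interior[of "{c..d}" w r] by auto
  then obtain \<epsilon> where \<epsilon>: "\<epsilon> > 0" "\<And>s. \<bar>s - r\<bar> < \<epsilon> \<Longrightarrow> \<bar>w s - w r\<bar> < w r / 2"
    using half_gt_zero[OF r(2)] unfolding continuous_at_eps_delta dist_real_def by blast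
  define b where "b = min (r + \<epsilon> / 2) ((r + d) / 2)"
  have b: "r < b" "b < d" "b < r + \<epsilon>" using r \<epsilon> by (auto simp: b_def min_def)
  have w: "w s \<ge> w r / 2" if "s \<in> {r..b}" for s
    using \<epsilon>(2)[of s] b that by (auto simp: abs_if split: if_splits)
  obtain P where P: "P > 0" "\<And>t. t \<in> {c..d} \<Longrightarrow> \<bar>p t\<bar> \<le> P"
    using compact_imp_bounded[OF compact_continuous_image[OF contp compact_Icc]]
    unfolding bounded_pos by auto
  obtain Q where Q: "Q > 0" "\<And>t. t \<in> {c..d} \<Longrightarrow> \<bar>q t\<bar> \<le> Q"
    using compact_imp_bounded[OF compact_continuous_image[OF contq compact_Icc]]
    unfolding bounded_pos by auto
  define k where "k = pi / (b - r)"
  have k: "k > 0" using b by (simp add: k_def)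
  define \<Lambda> where "\<Lambda> = (P * k\<^sup>2 + Q + 1) / (w r / 2)"
  have "P * k\<^sup>2 + Q + 1 > 0" using P Q by (intro add_nonneg_pos add_nonneg_nonneg) auto
  then have \<Lambda>: "\<Lambda> > 0" "\<Lambda> * (w r / 2) = P * k\<^sup>2 + Q + 1" using r by (simp_all add: \<Lambda>_def)
  have "\<exists>t\<in>{c<..<d}. U \<Lambda> t < 0"
  proof (rule ccontr)
    assume no: "\<not> ?thesis"
    then have pos: "U \<Lambda> t > 0" if "t \<in> {c<..<d}" for t
      using that shot_changes_sign[of \<Lambda> t] by force
    define \<phi> where "\<phi> = (\<lambda>s. sin (k * (s - r)))"
    define \<phi>' where "\<phi>' = (\<lambda>s. k * cos (k * (s - r)))"
    define G where "G = (\<lambda>s. (\<phi> s)\<^sup>2 * V \<Lambda> s / U \<Lambda> s - P * k / 2 * sin (2 * (k * (s - r))))"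
    have "G r > G b"
    proof (rule DERIV_neg_imp_decreasing_open[of r b G])
      show "r < b" by fact
      show "continuous_on {r..b} G"
        unfolding G_def \<phi>_def using pos r b
        by (intro continuous_intros continuous_on_subset[OF cont_U] continuous_on_subset[OF cont_V])
          (auto simp: less_imp_neq[symmetric])
      fix s assume s: "r < s" "s < b"
      have sd: "s \<in> {c<..<d}" "s \<in> {c..d}" using s r b by auto
      have d\<phi>: "(\<phi> has_real_derivative \<phi>' s) (at s)"
        unfolding \<phi>_def \<phi>'_def by (auto intro!: derivative_eq_intros)
      define X where "X = p s * (\<phi>' s)\<^sup>2 + (q s - \<Lambda> * w s) * (\<phi> s)\<^sup>2
         - p s * (\<phi>' s - \<phi> s * V \<Lambda> s / (p s * U \<Lambda> s))\<^sup>2"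
      have ps: "0 < p s" "p s \<le> P" using pos_p[OF sd(2)] P(2)[OF sd(2)] by auto
      have dG: "(G has_real_derivative X - P * k / 2 * (2 * k * cos (2 * (k * (s - r))))) (at s)"
        unfolding G_def X_def
        by (intro DERIV_diff picone_deriv[OF shot(1) sd(1) _ _ d\<phi>])
          (use pos[OF sd(1)] ps in \<open>auto intro!: derivative_eq_intros\<close>)
      have "0 < k * (s - r)" "k * (s - r) < pi"
        using s k b by (auto simp: k_def field_simps)
      then have \<phi>_pos: "\<phi> s > 0" unfolding \<phi>_def by (rule sin_gt_zero)
      have "\<Lambda> * w s \<ge> P * k\<^sup>2 + Q + 1"
        using mult_left_mono[OF w[of s], of \<Lambda>] \<Lambda>(1) s unfolding \<Lambda>(2)[symmetric] by simp
      then have "q s - \<Lambda> * w s \<le> - (P * k\<^sup>2) - 1" using Q(2)[OF sd(2)] by auto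
      then have "(q s - \<Lambda> * w s) * (\<phi> s)\<^sup>2 \<le> (- (P * k\<^sup>2) - 1) * (\<phi> s)\<^sup>2"
        by (rule mult_right_mono) simp
      moreover have "p s * (\<phi>' s)\<^sup>2 \<le> P * (\<phi>' s)\<^sup>2" using ps by (intro mult_right_mono) auto
      moreover have "p s * (\<phi>' s - \<phi> s * V \<Lambda> s / (p s * U \<Lambda> s))\<^sup>2 \<ge> 0" using ps by simp
      ultimately have "X \<le> P * (\<phi>' s)\<^sup>2 + (- (P * k\<^sup>2) - 1) * (\<phi> s)\<^sup>2" unfolding X_def by linarith
      also have "\<dots> = P * k / 2 * (2 * k * cos (2 * (k * (s - r)))) - (\<phi> s)\<^sup>2"
        unfolding \<phi>_def \<phi>'_def cos_double by (simp add: algebra_simps power2_eq_square)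
      finally have "X - P * k / 2 * (2 * k * cos (2 * (k * (s - r)))) \<le> - (\<phi> s)\<^sup>2" by simp
      also have "\<dots> < 0" using \<phi>_pos by simp
      finally show "\<exists>y. (G has_real_derivative y) (at s) \<and> y < 0" using dG by blast
    qed
    moreover have "k * (b - r) = pi" using b by (simp add: k_def)
    ultimately show False by (simp add: G_def \<phi>_def)
  qed
  then show ?thesis using \<Lambda>(1) by blast
qed

end

section \<open>First eigenvalues and subintervals\<close>

definition eig ::
  "(real \<Rightarrow> real) \<Rightarrow> (real \<Rightarrow> real) \<Rightarrow> (real \<Rightarrow> real) \<Rightarrow> real \<Rightarrow> real \<Rightarrow> real \<Rightarrow> bool" where
  "eig p q w c d l \<longleftrightarrow>
     (\<exists>u v. sl_sol p (\<lambda>t. q t - l * w t) c d u v \<and> u c = 0 \<and> u d = 0 \<and>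
            (\<exists>t\<in>{c..d}. u t \<noteq> 0))"

text \<open>Only positive eigenvalues are considered; the largest negative one for \<open>w\<close> is, up to
  sign, the first one for \<open>- w\<close>.\<close>
definition first_eig ::
  "(real \<Rightarrow> real) \<Rightarrow> (real \<Rightarrow> real) \<Rightarrow> (real \<Rightarrow> real) \<Rightarrow> real \<Rightarrow> real \<Rightarrow> real \<Rightarrow> bool" where
  "first_eig p q w c d l \<longleftrightarrow>
     0 < l \<and> eig p q w c d l \<and> (\<forall>k>0. eig p q w c d k \<longrightarrow> l \<le> k)"

lemma sl_sol_reflect:
  assumes "sl_sol p g c d u v"
  shows "sl_sol (\<lambda>t. p (- t)) (\<lambda>t. g (- t)) (- d) (- c) (\<lambda>t. u (- t)) (\<lambda>t. - v (- t))"
  unfolding sl_sol_def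
proof (intro ballI)
  fix t assume t: "t \<in> {- d..- c}"
  have img: "uminus ` {- d..- c} = {c..d}" by auto
  have D: "(u has_real_derivative v (- t) / p (- t)) (at (- t) within {c..d})"
    "(v has_real_derivative g (- t) * u (- t)) (at (- t) within {c..d})"
    using assms t unfolding sl_sol_def by auto
  have m: "(uminus has_real_derivative - 1) (at t within {- d..- c})"
    by (auto intro!: derivative_eq_intros)
  have "((\<lambda>t. u (- t)) has_real_derivative v (- t) / p (- t) * - 1) (at t within {- d..- c})"
    using DERIV_image_chain[of u _ uminus t "{- d..- c}", OF _ m] D(1) unfolding img by (simp add: o_def)
  moreover have "((\<lambda>t. v (- t)) has_real_derivative g (- t) * u (- t) * - 1) (at t within {- d..- c})"
    using DERIV_image_chain[of v _ uminus t "{- d..- c}", OF _ m] D(2) unfolding img by (simp add: o_def)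
  from DERIV_minus[OF this]
  have "((\<lambda>t. - v (- t)) has_real_derivative g (- t) * u (- t)) (at t within {- d..- c})" by simp
  ultimately show "((\<lambda>t. u (- t)) has_real_derivative - v (- t) / p (- t)) (at t within {- d..- c}) \<and>
    ((\<lambda>t. - v (- t)) has_real_derivative g (- t) * u (- t)) (at t within {- d..- c})"
    by simp
qed

lemma pos_sol_reflect:
  "pos_sol (\<lambda>t. p (- t)) (\<lambda>t. q (- t)) (\<lambda>t. w (- t)) (- d) (- c) l \<longleftrightarrow> pos_sol p q w c d l"
proof -
  have *: "pos_sol (\<lambda>t. p (- t)) (\<lambda>t. q (- t)) (\<lambda>t. w (- t)) (- d) (- c) l"
    if sol: "pos_sol p q w c d l" for p q w c d
  proof -
    obtain u v where uv: "sl_sol p (\<lambda>t. q t - l * w t) c d u v" "u c = 0" "u d = 0"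
      "\<forall>t\<in>{c<..<d}. u t > 0"
      using sol unfolding pos_sol_def by auto
    then show ?thesis
      unfolding pos_sol_def using sl_sol_reflect[OF uv(1)]
      by (intro exI[of _ "\<lambda>t. u (- t)"] exI[of _ "\<lambda>t. - v (- t)"]) auto
  qed
  show ?thesis
    using *[of p q w c d] *[of "\<lambda>t. p (- t)" "\<lambda>t. q (- t)" "\<lambda>t. w (- t)" "- d" "- c"] by auto
qed

lemma eig_reflect:
  "eig (\<lambda>t. p (- t)) (\<lambda>t. q (- t)) (\<lambda>t. w (- t)) (- d) (- c) l \<longleftrightarrow> eig p q w c d l"
proof -
  have *: "eig (\<lambda>t. p (- t)) (\<lambda>t. q (- t)) (\<lambda>t. w (- t)) (- d) (- c) l"
    if sol: "eig p q w c d l" for p q w c d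
  proof -
    obtain u v r where uv: "sl_sol p (\<lambda>t. q t - l * w t) c d u v" "u c = 0" "u d = 0"
      "r \<in> {c..d}" "u r \<noteq> 0"
      using sol unfolding eig_def by auto
    then show ?thesis
      unfolding eig_def using sl_sol_reflect[OF uv(1)]
      by (intro exI[of _ "\<lambda>t. u (- t)"] exI[of _ "\<lambda>t. - v (- t)"]) (auto intro!: bexI[of _ "- r"])
  qed
  show ?thesis
    using *[of p q w c d] *[of "\<lambda>t. p (- t)" "\<lambda>t. q (- t)" "\<lambda>t. w (- t)" "- d" "- c"] by auto
qed

lemma first_eig_reflect:
  "first_eig (\<lambda>t. p (- t)) (\<lambda>t. q (- t)) (\<lambda>t. w (- t)) (- d) (- c) l \<longleftrightarrow> first_eig p q w c d l"
  by (simp add: first_eig_def eig_reflect)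

lemma continuous_on_reflect:
  fixes f :: "real \<Rightarrow> real"
  assumes "continuous_on {c..d} f"
  shows "continuous_on {- d..- c} (\<lambda>t. f (- t))"
  by (rule continuous_on_compose2[OF assms]) (auto intro!: continuous_intros)

lemma sl_problem_reflect:
  assumes "sl_problem p q w c d"
  shows "sl_problem (\<lambda>t. p (- t)) (\<lambda>t. q (- t)) (\<lambda>t. w (- t)) (- d) (- c)"
  using assms by (auto simp: sl_problem_def intro: continuous_on_reflect)

lemma sl_problem_subinterval:
  assumes "sl_problem p q w c d" "c \<le> a" "a < b" "b \<le> d"
  shows "sl_problem p q w a b"
proof -
  have "{a..b} \<subseteq> {c..d}" using assms by auto
  then show ?thesis
    using assms unfolding sl_problem_def by (auto intro: continuous_on_subset)
qed

context sl_problem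
begin

lemma eig_iff: "eig p q w c d l \<longleftrightarrow> U l d = 0"
proof
  assume "eig p q w c d l"
  then obtain u v r where uv: "sl_sol p (\<lambda>t. q t - l * w t) c d u v" "u c = 0" "u d = 0"
    "r \<in> {c..d}" "u r \<noteq> 0"
    unfolding eig_def by auto
  note prp = shot_proportional(1)[OF uv(1,2) order_refl]
  have "v c \<noteq> 0" using prp[OF uv(4)] uv(5) by auto
  then show "U l d = 0" using prp[of d] uv(3) cd by auto
next
  assume "U l d = 0"
  moreover obtain \<eta> where "\<eta> > c" "\<eta> \<le> d" "\<forall>t\<in>{c<..\<eta>}. U l t > 0"
    using shot_pos_start by blast
  ultimately show "eig p q w c d l"
    unfolding eig_def using shot[of l]
    by (intro exI[of _ "U l"] exI[of _ "V l"]) (force intro!: bexI[of _ \<eta>])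
qed

text \<open>If the eigenfunction took a negative value, there would be a smaller principal eigenvalue;
  and below a principal eigenvalue \<open>U\<close> does not vanish at \<open>d\<close>.\<close>
lemma first_eig_iff_pos_sol: "first_eig p q w c d l \<longleftrightarrow> 0 < l \<and> pos_sol p q w c d l"
proof
  assume f: "first_eig p q w c d l"
  then have l: "0 < l" "U l d = 0" by (auto simp: first_eig_def eig_iff)
  have "\<not> U l t < 0" if t: "t \<in> {c<..<d}" for t
  proof
    assume "U l t < 0"
    then obtain \<beta> where "0 < \<beta>" "\<beta> < l" "pos_sol p q w c d \<beta>"
      using shot_neg_imp_pos_sol[OF l(1) t] by auto
    then show False using f pos_sol_iff[of d \<beta>] cd by (auto simp: first_eig_def eig_iff)
  qed
  then show "0 < l \<and> pos_sol p q w c d l" using shot_trichotomy[of l] l cd by force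
next
  assume l: "0 < l \<and> pos_sol p q w c d l"
  then have U: "\<And>t. t \<in> {c<..<d} \<Longrightarrow> U l t > 0" "U l d = 0" using pos_sol_iff[of d l] cd by auto
  have "l \<le> k" if "k > 0" "U k d = 0" for k
    using shot_pos_below[of k l d d] U that cd by force
  then show "first_eig p q w c d l" using l U by (auto simp: first_eig_def eig_iff)
qed

lemma ex_pos_sol:
  assumes "r \<in> {c<..<d}" "w r > 0"
  shows "\<exists>\<beta>>0. pos_sol p q w c d \<beta>"
  using shot_oscillates[of r] shot_neg_imp_pos_sol assms by blast

text \<open>The eigenfunction is positive on the compact interval up to \<open>s < d\<close>, apart from the simple zero at
  \<open>c\<close>, and remains so for parameters near \<open>\<alpha>\<close>. Positivity at \<open>t \<le> s\<close> excludes an arch on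
  \<open>[c, t]\<close>.\<close>
lemma first_eig_gap:
  assumes "first_eig p q w c d \<alpha>" "s < d"
  shows "\<exists>\<delta>>0. \<forall>t l. c < t \<longrightarrow> t \<le> s \<longrightarrow> pos_sol p q w c t l \<longrightarrow> \<delta> \<le> \<bar>l - \<alpha>\<bar>"
proof (cases "c < s")
  case True
  have "U \<alpha> t > 0" if "t \<in> {c<..s}" for t
    using assms that pos_sol_iff[of d \<alpha>] cd by (auto simp: first_eig_iff_pos_sol)
  from shot_pos_stable[OF this True] obtain \<delta> where
    \<delta>: "\<delta> > 0" "\<And>l t. \<bar>l - \<alpha>\<bar> < \<delta> \<Longrightarrow> t \<in> {c<..s} \<Longrightarrow> U l t > 0"
    using assms(2) by auto
  have "\<delta> \<le> \<bar>l - \<alpha>\<bar>" if "c < t" "t \<le> s" "pos_sol p q w c t l" for t l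
    using \<delta>(2)[of l t] pos_sol_iff[of t l] that assms(2) by force
  then show ?thesis using \<delta>(1) by blast
qed (auto intro: exI[of _ 1])

text \<open>Positive principal eigenvalues tend to infinity as the interval shrinks to \<open>c\<close>: \<open>U A\<close> is positive
  on some \<open>(c, \<eta>]\<close>, hence so is \<open>U l\<close> for \<open>0 < l \<le> A\<close>.\<close>
lemma pos_sol_short_interval:
  assumes "A > 0"
  shows "\<exists>\<eta>>c. \<eta> \<le> d \<and> (\<forall>t l. c < t \<longrightarrow> t \<le> \<eta> \<longrightarrow> 0 < l \<longrightarrow> pos_sol p q w c t l \<longrightarrow> A < l)"
proof -
  obtain \<eta> where \<eta>: "\<eta> > c" "\<eta> \<le> d" "\<forall>t\<in>{c<..\<eta>}. U A t > 0" using shot_pos_start by blast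
  have "A < l" if t: "c < t" "t \<le> \<eta>" and l: "0 < l" "pos_sol p q w c t l" for t l
  proof (rule ccontr)
    assume "\<not> A < l"
    then have "U l t > 0"
      using shot_pos_below[of l A \<eta> t] \<eta> t l by (cases "l = A") auto
    then show False using pos_sol_iff[of t l] t l \<eta> by auto
  qed
  then show ?thesis using \<eta> by blast
qed

text \<open>The bound is uniform in \<open>e \<ge> d\<close>; it forces intervals with large principal eigenvalues to be
  short.\<close>
lemma pos_sol_bounded:
  assumes "r \<in> {c<..<d}" "w r > 0"
  shows "\<exists>A>0. \<forall>e l. d \<le> e \<longrightarrow> pos_sol p q w c e l \<longrightarrow> l \<le> A"
proof -
  obtain A t where A: "A > 0" "t \<in> {c<..<d}" "U A t < 0"
    using shot_oscillates[OF assms] by blast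
  have "l \<le> A" if e: "d \<le> e" and l: "pos_sol p q w c e l" for e l
  proof (rule ccontr)
    assume "\<not> l \<le> A"
    obtain u v where uv: "sl_sol p (\<lambda>t. q t - l * w t) c e u v" "u c = 0"
      "\<forall>t\<in>{c<..<e}. u t > 0"
      using l unfolding pos_sol_def by auto
    have "sl_sol p (\<lambda>t. q t - l * w t) c d u v"
      using sl_sol_subinterval[OF uv(1)] e by auto
    note prp = shot_proportional(1)[OF this uv(2) order_refl]
    have "U l s \<noteq> 0" if "s \<in> {c<..<d}" for s
      using prp[of s] uv(3) that e by force
    then have "\<And>s. s \<in> {c<..<d} \<Longrightarrow> U l s > 0" using shot_pos_if_nonzero by blast
    from shot_pos_below[of A l d t, OF _ _ _ _ this] show False
      using A cd \<open>\<not> l \<le> A\<close> by auto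
  qed
  then show ?thesis using A(1) by blast
qed

text \<open>The shot for \<open>\<beta> + \<epsilon>\<close> is not positive at some \<open>z < d\<close>, since otherwise \<open>U \<beta> d\<close> would be
  positive; an arch that ends between \<open>z\<close> and \<open>d\<close> therefore has a parameter below \<open>\<beta> + \<epsilon>\<close>.\<close>
lemma pos_sol_tendsto_first_eig:
  assumes \<beta>: "first_eig p q w c d \<beta>" and "\<epsilon> > 0"
  shows "\<exists>z<d. \<forall>t l. z < t \<longrightarrow> c < t \<longrightarrow> t < d \<longrightarrow> 0 < l \<longrightarrow> pos_sol p q w c t l \<longrightarrow> \<bar>l - \<beta>\<bar> < \<epsilon>"
proof -
  have b: "\<beta> > 0" "\<And>t. t \<in> {c<..<d} \<Longrightarrow> U \<beta> t > 0" "U \<beta> d = 0"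
    using \<beta> pos_sol_iff[of d \<beta>] cd by (auto simp: first_eig_iff_pos_sol)
  obtain z where z: "z \<in> {c<..<d}" "U (\<beta> + \<epsilon>) z \<le> 0"
    using shot_pos_below[of \<beta> "\<beta> + \<epsilon>" d d] b \<open>\<epsilon> > 0\<close> cd by force
  have "\<bar>l - \<beta>\<bar> < \<epsilon>" if t: "z < t" "c < t" "t < d" and l: "0 < l" "pos_sol p q w c t l" for t l
  proof -
    have U: "\<And>s. s \<in> {c<..<t} \<Longrightarrow> U l s > 0" "U l t = 0"
      using pos_sol_iff[of t l] t l by auto
    have "\<beta> \<le> l" using shot_pos_below[of l \<beta> d t] b l U t by force
    moreover have "l \<noteq> \<beta> + \<epsilon>" using U(1)[of z] z t by auto
    moreover have "\<not> \<beta> + \<epsilon> < l"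
      using shot_pos_below[of "\<beta> + \<epsilon>" l t z] b \<open>\<epsilon> > 0\<close> U(1) z t by force
    ultimately show ?thesis by linarith
  qed
  then show ?thesis using z by (intro exI[of _ z]) auto
qed

end

lemma first_eig_gap_right:
  assumes "sl_problem p q w c d" "first_eig p q w c d \<alpha>" "c < s"
  shows "\<exists>\<delta>>0. \<forall>t l. s \<le> t \<longrightarrow> t < d \<longrightarrow> pos_sol p q w t d l \<longrightarrow> \<delta> \<le> \<bar>l - \<alpha>\<bar>"
proof -
  from sl_problem.first_eig_gap[OF sl_problem_reflect[OF assms(1)], of \<alpha> "- s"]
  obtain \<delta> where \<delta>: "\<delta> > 0" "\<And>t l. - d < t \<Longrightarrow> t \<le> - s \<Longrightarrow>
      pos_sol (\<lambda>t. p (- t)) (\<lambda>t. q (- t)) (\<lambda>t. w (- t)) (- d) t l \<Longrightarrow> \<delta> \<le> \<bar>l - \<alpha>\<bar>"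
    using assms(2,3) by (auto simp: first_eig_reflect)
  have "\<delta> \<le> \<bar>l - \<alpha>\<bar>" if "s \<le> t" "t < d" "pos_sol p q w t d l" for t l
    using \<delta>(2)[of "- t" l] that by (simp add: pos_sol_reflect)
  then show ?thesis using \<delta>(1) by blast
qed

text \<open>The behaviour of the pairs of principal eigenvalues of the two parts of \<open>[c, d]\<close> cut at \<open>t\<close>. Since
  \<open>w2\<close> is positive somewhere in \<open>(z, d)\<close> for every \<open>z\<close>, the values \<open>x\<close> for arches starting at or
  before \<open>z\<close> are bounded, so large \<open>x\<close> means that \<open>t\<close> is close to \<open>d\<close>, where \<open>y\<close> is close to \<open>\<beta>\<close>.
  Conversely every \<open>t\<close> close to \<open>d\<close> yields such a pair.\<close>
lemma weight_at_right_end: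
  assumes 1: "sl_problem p q w1 c d" and 2: "sl_problem p q w2 c d"
    and r: "r \<in> {c<..<d}" "w1 r > 0"
    and acc: "\<And>z. c \<le> z \<Longrightarrow> z < d \<Longrightarrow> \<exists>s\<in>{z<..<d}. w2 s > 0"
  shows "\<exists>\<beta>. first_eig p q w1 c d \<beta> \<and>
    (\<forall>\<epsilon>>0. \<exists>A. \<forall>t x y. c < t \<longrightarrow> t < d \<longrightarrow> A < x \<longrightarrow> 0 < y \<longrightarrow>
        pos_sol p q w1 c t y \<longrightarrow> pos_sol p q w2 t d x \<longrightarrow> \<bar>y - \<beta>\<bar> < \<epsilon>) \<and>
    (\<forall>A. \<exists>t x y. c < t \<and> t < d \<and> A < x \<and> 0 < x \<and> 0 < y \<and> pos_sol p q w1 c t y \<and> pos_sol p q w2 t d x)"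
proof -
  interpret P1: sl_problem p q w1 c d by fact
  interpret P2: sl_problem p q w2 c d by fact
  have cd: "c < d" by (rule P1.cd)
  obtain \<beta> where \<beta>: "first_eig p q w1 c d \<beta>"
    using P1.ex_pos_sol[OF r] P1.first_eig_iff_pos_sol by auto
  have large: "\<exists>A. \<forall>t x. c < t \<longrightarrow> t < d \<longrightarrow> A < x \<longrightarrow> pos_sol p q w2 t d x \<longrightarrow> z < t"
    if z: "c \<le> z" "z < d" for z
  proof -
    obtain s where s: "s \<in> {z<..<d}" "w2 s > 0" using acc[OF z] by blast
    have "sl_problem (\<lambda>t. p (- t)) (\<lambda>t. q (- t)) (\<lambda>t. w2 (- t)) (- d) (- z)"
      using sl_problem_reflect[OF sl_problem_subinterval[OF 2, of z d]] z by auto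
    from sl_problem.pos_sol_bounded[OF this, of "- s"] s obtain A where
      A: "\<And>e l. - z \<le> e \<Longrightarrow> pos_sol (\<lambda>t. p (- t)) (\<lambda>t. q (- t)) (\<lambda>t. w2 (- t)) (- d) e l \<Longrightarrow> l \<le> A"
      by auto
    have "z < t" if "A < x" "pos_sol p q w2 t d x" for t x
      using A[of "- t" x] that by (force simp: pos_sol_reflect)
    then show ?thesis by blast
  qed
  have "\<exists>A. \<forall>t x y. c < t \<longrightarrow> t < d \<longrightarrow> A < x \<longrightarrow> 0 < y \<longrightarrow>
        pos_sol p q w1 c t y \<longrightarrow> pos_sol p q w2 t d x \<longrightarrow> \<bar>y - \<beta>\<bar> < \<epsilon>" if \<epsilon>: "\<epsilon> > 0" for \<epsilon>
  proof -
    obtain z where z: "z < d" "\<And>t l. z < t \<Longrightarrow> c < t \<Longrightarrow> t < d \<Longrightarrow> 0 < l \<Longrightarrow>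
        pos_sol p q w1 c t l \<Longrightarrow> \<bar>l - \<beta>\<bar> < \<epsilon>"
      using P1.pos_sol_tendsto_first_eig[OF \<beta> \<epsilon>] by blast
    obtain A where "\<And>t x. c < t \<Longrightarrow> t < d \<Longrightarrow> A < x \<Longrightarrow> pos_sol p q w2 t d x \<Longrightarrow> max c z < t"
      using large[of "max c z"] z(1) cd by auto
    then show ?thesis using z(2) by (intro exI[of _ A]) force
  qed
  moreover have "\<exists>t x y. c < t \<and> t < d \<and> A < x \<and> 0 < x \<and> 0 < y \<and> pos_sol p q w1 c t y \<and> pos_sol p q w2 t d x" for A
  proof -
    from sl_problem.pos_sol_short_interval[OF sl_problem_reflect[OF 2], of "\<bar>A\<bar> + 1"]
    obtain \<eta> where \<eta>: "\<eta> > - d" "\<eta> \<le> - c" "\<And>t l. - d < t \<Longrightarrow> t \<le> \<eta> \<Longrightarrow> 0 < l \<Longrightarrow>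
        pos_sol (\<lambda>t. p (- t)) (\<lambda>t. q (- t)) (\<lambda>t. w2 (- t)) (- d) t l \<Longrightarrow> \<bar>A\<bar> + 1 < l"
      by (metis abs_ge_zero add_nonneg_pos zero_less_one)
    obtain t where t: "max r (- \<eta>) < t" "t < d"
      using dense[of "max r (- \<eta>)" d] r \<eta> by auto
    have tc: "c < t" "t < d" using t r by auto
    obtain y where y: "y > 0" "pos_sol p q w1 c t y"
      using sl_problem.ex_pos_sol[OF sl_problem_subinterval[OF 1, of c t], of r] tc t r by auto
    obtain s where s: "s \<in> {t<..<d}" "w2 s > 0" using acc[of t] tc by auto
    obtain x where x: "x > 0" "pos_sol p q w2 t d x"
      using sl_problem.ex_pos_sol[OF sl_problem_subinterval[OF 2, of t d], of s] tc s by auto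
    have "\<bar>A\<bar> + 1 < x"
      using \<eta>(3)[of "- t" x] t x by (simp add: pos_sol_reflect)
    then have "A < x" by linarith
    then show ?thesis using tc x y by blast
  qed
  ultimately show ?thesis using \<beta> by blast
qed

text \<open>The situation at \<open>c\<close>, obtained by the reflection \<open>t \<mapsto> - t\<close>: now the arch for \<open>w2\<close> comes first.\<close>
lemma weight_at_left_end:
  assumes 1: "sl_problem p q w1 c d" and 2: "sl_problem p q w2 c d"
    and r: "r \<in> {c<..<d}" "w1 r > 0"
    and acc: "\<And>z. c < z \<Longrightarrow> z \<le> d \<Longrightarrow> \<exists>s\<in>{c<..<z}. w2 s > 0"
  shows "\<exists>\<beta>. first_eig p q w1 c d \<beta> \<and>
    (\<forall>\<epsilon>>0. \<exists>A. \<forall>t x y. c < t \<longrightarrow> t < d \<longrightarrow> A < x \<longrightarrow> 0 < y \<longrightarrow>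
        pos_sol p q w1 t d y \<longrightarrow> pos_sol p q w2 c t x \<longrightarrow> \<bar>y - \<beta>\<bar> < \<epsilon>) \<and>
    (\<forall>A. \<exists>t x y. c < t \<and> t < d \<and> A < x \<and> 0 < x \<and> 0 < y \<and> pos_sol p q w1 t d y \<and> pos_sol p q w2 c t x)"
proof -
  have acc': "\<exists>s\<in>{z<..<- c}. w2 (- s) > 0" if "- d \<le> z" "z < - c" for z
  proof -
    obtain s where "s \<in> {c<..<- z}" "w2 s > 0" using acc[of "- z"] \<open>- d \<le> z\<close> \<open>z < - c\<close> by auto
    then show ?thesis by (intro bexI[of _ "- s"]) auto
  qed
  obtain \<beta> where \<beta>: "first_eig p q w1 c d \<beta>"
    and near: "\<And>\<epsilon>. \<epsilon> > 0 \<Longrightarrow> \<exists>A. \<forall>t x y. - d < t \<longrightarrow> t < - c \<longrightarrow> A < x \<longrightarrow> 0 < y \<longrightarrow>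
        pos_sol (\<lambda>t. p (- t)) (\<lambda>t. q (- t)) (\<lambda>t. w1 (- t)) (- d) t y \<longrightarrow>
        pos_sol (\<lambda>t. p (- t)) (\<lambda>t. q (- t)) (\<lambda>t. w2 (- t)) t (- c) x \<longrightarrow> \<bar>y - \<beta>\<bar> < \<epsilon>"
    and far: "\<And>A. \<exists>t x y. - d < t \<and> t < - c \<and> A < x \<and> 0 < x \<and> 0 < y \<and>
        pos_sol (\<lambda>t. p (- t)) (\<lambda>t. q (- t)) (\<lambda>t. w1 (- t)) (- d) t y \<and>
        pos_sol (\<lambda>t. p (- t)) (\<lambda>t. q (- t)) (\<lambda>t. w2 (- t)) t (- c) x"
    using weight_at_right_end[OF sl_problem_reflect[OF 1] sl_problem_reflect[OF 2], of "- r"] r acc'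
    by (auto simp: first_eig_reflect)
  have refl1: "pos_sol (\<lambda>t. p (- t)) (\<lambda>t. q (- t)) (\<lambda>t. w (- t)) (- d) t l \<longleftrightarrow> pos_sol p q w (- t) d l"
    and refl2: "pos_sol (\<lambda>t. p (- t)) (\<lambda>t. q (- t)) (\<lambda>t. w (- t)) t (- c) l \<longleftrightarrow> pos_sol p q w c (- t) l"
    for w t l
    using pos_sol_reflect[of p q w d "- t" l] pos_sol_reflect[of p q w "- t" c l] by simp_all
  have "\<exists>A. \<forall>t x y. c < t \<longrightarrow> t < d \<longrightarrow> A < x \<longrightarrow> 0 < y \<longrightarrow>
        pos_sol p q w1 t d y \<longrightarrow> pos_sol p q w2 c t x \<longrightarrow> \<bar>y - \<beta>\<bar> < \<epsilon>" if \<epsilon>: "\<epsilon> > 0" for \<epsilon>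
  proof -
    obtain A where A: "\<And>t x y. - d < t \<Longrightarrow> t < - c \<Longrightarrow> A < x \<Longrightarrow> 0 < y \<Longrightarrow>
        pos_sol p q w1 (- t) d y \<Longrightarrow> pos_sol p q w2 c (- t) x \<Longrightarrow> \<bar>y - \<beta>\<bar> < \<epsilon>"
      using near[OF \<epsilon>] unfolding refl1 refl2 by blast
    have "\<bar>y - \<beta>\<bar> < \<epsilon>" if "c < t" "t < d" "A < x" "0 < y" "pos_sol p q w1 t d y" "pos_sol p q w2 c t x"
      for t x y
      using A[of "- t" x y] that by simp
    then show ?thesis by blast
  qed
  moreover have "\<exists>t x y. c < t \<and> t < d \<and> A < x \<and> 0 < x \<and> 0 < y \<and> pos_sol p q w1 t d y \<and> pos_sol p q w2 c t x" for A
  proof -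
    obtain t x y where "- d < t" "t < - c" "A < x" "0 < x" "0 < y" "pos_sol p q w1 (- t) d y" "pos_sol p q w2 c (- t) x"
      using far[of A] unfolding refl1 refl2 by blast
    then show ?thesis by (intro exI[of _ "- t"] exI[of _ x] exI[of _ y]) auto
  qed
  ultimately show ?thesis using \<beta> by blast
qed

section \<open>Solutions with one interior zero as pairs of arches\<close>

lemma deriv_on_eq:
  assumes "T1 < T2" "t \<in> {T1..T2}" "(u has_real_derivative D) (at t within {T1..T2})"
  shows "deriv_on T1 T2 u t = D"
  unfolding deriv_on_def using assms
  by (intro vector_derivative_within_closed_interval) (auto simp: has_real_derivative_iff_has_vector_derivative)

lemma C1_on_deriv:
  assumes "C1_on T1 T2 u" "t \<in> {T1..T2}"
  shows "(u has_real_derivative deriv_on T1 T2 u t) (at t within {T1..T2})"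
  using assms unfolding C1_on_def deriv_on_def differentiable_on_def
    has_real_derivative_iff_has_vector_derivative by (simp add: vector_derivative_works)

lemma C1_onI:
  assumes "T1 < T2" "\<And>t. t \<in> {T1..T2} \<Longrightarrow> (u has_real_derivative D t) (at t within {T1..T2})"
    and "continuous_on {T1..T2} D"
  shows "C1_on T1 T2 u"
proof -
  have "u differentiable_on {T1..T2}"
    unfolding differentiable_on_def using assms(2) real_differentiable_def
    by (metis has_field_derivative_imp_has_derivative differentiable_def)
  moreover have "continuous_on {T1..T2} (deriv_on T1 T2 u)"
    using assms(3) by (rule continuous_on_eq) (use deriv_on_eq[OF assms(1) _ assms(2)] in auto)
  ultimately show ?thesis by (simp add: C1_on_def)
qed

text \<open>The right-hand side \<open>f\<close> is allowed to depend on \<open>u\<close>, so that the linear eigenvalue problem and the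
  problem with \<open>u\<^sup>+\<close> and \<open>u\<^sup>-\<close> are both instances; its continuity may use that of \<open>u\<close>.\<close>
lemma SL_equation_iff:
  assumes "T1 < T2" and contp: "continuous_on {T1..T2} p" and contq: "continuous_on {T1..T2} q"
    and pos: "\<And>t. t \<in> {T1..T2} \<Longrightarrow> p t > 0"
    and f: "continuous_on {T1..T2} u \<Longrightarrow> continuous_on {T1..T2} f"
  shows "SL_regular T1 T2 p u \<and> (\<forall>t\<in>{T1<..<T2}. SL_op T1 T2 p q u t = f t) \<longleftrightarrow>
    (\<exists>v. \<forall>t\<in>{T1..T2}. (u has_real_derivative v t / p t) (at t within {T1..T2}) \<and>
       (v has_real_derivative q t * u t - f t) (at t within {T1..T2}))"
proof
  assume L: "SL_regular T1 T2 p u \<and> (\<forall>t\<in>{T1<..<T2}. SL_op T1 T2 p q u t = f t)"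
  define v where "v = (\<lambda>t. p t * deriv_on T1 T2 u t)"
  have C1: "C1_on T1 T2 u" "C1_on T1 T2 v" using L by (auto simp: SL_regular_def v_def)
  have contu: "continuous_on {T1..T2} u"
    using C1_on_deriv[OF C1(1)] by (rule DERIV_continuous_on)
  \<comment> \<open>The equation extends to the end points by continuity.\<close>
  have "deriv_on T1 T2 v t - (q t * u t - f t) = 0" if t: "t \<in> {T1..T2}" for t
  proof (rule continuous_constant_on_closure[of "{T1<..<T2}" "\<lambda>t. deriv_on T1 T2 v t - (q t * u t - f t)"])
    show "continuous_on (closure {T1<..<T2}) (\<lambda>t. deriv_on T1 T2 v t - (q t * u t - f t))"
      using assms C1(2) contu unfolding C1_on_def
      by (auto intro!: continuous_intros simp: closure_greaterThanLessThan)
    show "deriv_on T1 T2 v s - (q s * u s - f s) = 0" if "s \<in> {T1<..<T2}" for s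
      using L that unfolding SL_op_def v_def by force
    show "t \<in> closure {T1<..<T2}" using assms t by (simp add: closure_greaterThanLessThan)
  qed
  then have "(u has_real_derivative v t / p t) (at t within {T1..T2}) \<and>
       (v has_real_derivative q t * u t - f t) (at t within {T1..T2})" if "t \<in> {T1..T2}" for t
    using C1_on_deriv[OF C1(1) that] C1_on_deriv[OF C1(2) that] pos[OF that] that by (simp add: v_def)
  then show "\<exists>v. \<forall>t\<in>{T1..T2}. (u has_real_derivative v t / p t) (at t within {T1..T2}) \<and>
       (v has_real_derivative q t * u t - f t) (at t within {T1..T2})" by blast
next
  assume "\<exists>v. \<forall>t\<in>{T1..T2}. (u has_real_derivative v t / p t) (at t within {T1..T2}) \<and>
       (v has_real_derivative q t * u t - f t) (at t within {T1..T2})"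
  then obtain v where
    u: "\<And>t. t \<in> {T1..T2} \<Longrightarrow> (u has_real_derivative v t / p t) (at t within {T1..T2})" and
    v: "\<And>t. t \<in> {T1..T2} \<Longrightarrow> (v has_real_derivative q t * u t - f t) (at t within {T1..T2})"
    by blast
  have contu: "continuous_on {T1..T2} u" and contv: "continuous_on {T1..T2} v"
    using DERIV_continuous_on[OF u] DERIV_continuous_on[OF v] by auto
  have eq: "p t * deriv_on T1 T2 u t = v t" if "t \<in> {T1..T2}" for t
    using deriv_on_eq[OF assms(1) that u[OF that]] pos[OF that] by simp
  have d: "((\<lambda>t. p t * deriv_on T1 T2 u t) has_real_derivative q t * u t - f t) (at t within {T1..T2})"
    if "t \<in> {T1..T2}" for t
    using has_field_derivative_transform_within[OF v[OF that], of 1] eq that by auto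
  have "C1_on T1 T2 u"
    by (rule C1_onI[OF assms(1) u])
      (use contv contp pos in \<open>auto intro!: continuous_intros simp: less_imp_neq[symmetric]\<close>)
  moreover have "C1_on T1 T2 (\<lambda>t. p t * deriv_on T1 T2 u t)"
    by (rule C1_onI[OF assms(1) d]) (auto intro!: continuous_intros contq contu f)
  ultimately show "SL_regular T1 T2 p u \<and> (\<forall>t\<in>{T1<..<T2}. SL_op T1 T2 p q u t = f t)"
    using deriv_on_eq[OF assms(1) _ d] by (auto simp: SL_regular_def SL_op_def)
qed

lemma SL_eigenvalue_iff:
  assumes "sl_problem p q w T1 T2"
  shows "SL_eigenvalue T1 T2 p q w l \<longleftrightarrow> eig p q w T1 T2 l"
proof -
  interpret sl_problem p q w T1 T2 by fact
  have "SL_regular T1 T2 p u \<and> (\<forall>t\<in>{T1<..<T2}. SL_op T1 T2 p q u t = l * w t * u t) \<longleftrightarrow>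
      (\<exists>v. sl_sol p (\<lambda>t. q t - l * w t) T1 T2 u v)" for u
    unfolding sl_sol_def left_diff_distrib
    by (rule SL_equation_iff[OF cd contp contq pos_p]) (auto intro!: continuous_intros contw)
  then show ?thesis unfolding SL_eigenvalue_def eig_def by blast
qed

text \<open>The right-hand side \<open>a m u\<^sup>+ - b n u\<^sup>-\<close> is \<open>u\<close> times a weight that depends on the sign of
  \<open>u\<close>. At zeros of \<open>u\<close> the choice of the weight is immaterial.\<close>
lemma solves_P_iff:
  assumes "sl_problem p q m T1 T2" "sl_problem p q n T1 T2"
  shows "solves_P T1 T2 p q m n a b u \<longleftrightarrow>
    (\<exists>v. sl_sol p (\<lambda>t. q t - (if u t > 0 then a * m t else b * n t)) T1 T2 u v) \<and> u T1 = 0 \<and> u T2 = 0"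
proof -
  interpret M: sl_problem p q m T1 T2 by fact
  interpret N: sl_problem p q n T1 T2 by fact
  have eq: "(q t - (if u t > 0 then a * m t else b * n t)) * u t =
      q t * u t - (a * m t * max (u t) 0 - b * n t * max (- u t) 0)" for t
    by (auto simp: max_def algebra_simps)
  have "SL_regular T1 T2 p u \<and>
       (\<forall>t\<in>{T1<..<T2}. SL_op T1 T2 p q u t = a * m t * max (u t) 0 - b * n t * max (- u t) 0) \<longleftrightarrow>
      (\<exists>v. sl_sol p (\<lambda>t. q t - (if u t > 0 then a * m t else b * n t)) T1 T2 u v)"
    unfolding sl_sol_def eq
    by (rule SL_equation_iff[OF M.cd M.contp M.contq M.pos_p])
      (auto intro!: continuous_intros M.contw N.contw)
  then show ?thesis unfolding solves_P_def by blast
qed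

lemma trivial_values_sign:
  assumes "sl_problem p q w T1 T2" "l \<in> trivial_values T1 T2 p q w"
  shows "\<exists>\<sigma>\<in>{1, - 1}. first_eig p q (\<lambda>t. \<sigma> * w t) T1 T2 (\<sigma> * l)"
proof -
  have neg: "eig p q (\<lambda>t. - w t) T1 T2 k \<longleftrightarrow> eig p q w T1 T2 (- k)" for k
    by (simp add: eig_def)
  show ?thesis
  proof (cases "is_lambda_pos T1 T2 p q w l")
    case True
    then show ?thesis
      by (simp add: is_lambda_pos_def first_eig_def SL_eigenvalue_iff[OF assms(1)])
  next
    case False
    then have "is_lambda_neg T1 T2 p q w l" using assms(2) by (simp add: trivial_values_def)
    then have "first_eig p q (\<lambda>t. - w t) T1 T2 (- l)"
      unfolding is_lambda_neg_def first_eig_def SL_eigenvalue_iff[OF assms(1)] neg by force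
    then show ?thesis by simp
  qed
qed

lemma sign_trivial_values:
  assumes "sl_problem p q w T1 T2" "\<sigma> \<in> {1, - 1}" "first_eig p q (\<lambda>t. \<sigma> * w t) T1 T2 \<beta>"
  shows "\<sigma> * \<beta> \<in> trivial_values T1 T2 p q w"
proof -
  have neg: "eig p q (\<lambda>t. - w t) T1 T2 k \<longleftrightarrow> eig p q w T1 T2 (- k)" for k
    by (simp add: eig_def)
  show ?thesis
  proof (cases "\<sigma> = 1")
    case True
    then show ?thesis using assms(3)
      by (simp add: trivial_values_def is_lambda_pos_def first_eig_def SL_eigenvalue_iff[OF assms(1)])
  next
    case False
    then have "first_eig p q (\<lambda>t. - w t) T1 T2 \<beta>" "\<sigma> = - 1" using assms by auto
    then have "is_lambda_neg T1 T2 p q w (- \<beta>)"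
      unfolding is_lambda_neg_def first_eig_def SL_eigenvalue_iff[OF assms(1)] neg
      by (metis minus_minus neg_0_less_iff_less neg_less_0_iff_less le_minus_iff)
    then show ?thesis using \<open>\<sigma> = - 1\<close> by (simp add: trivial_values_def)
  qed
qed

lemma sl_problem_sign:
  assumes "sl_problem p q w c d" shows "sl_problem p q (\<lambda>t. \<sigma> * w t) c d"
  using assms by (auto simp: sl_problem_def intro!: continuous_intros)

lemma pos_sol_sign:
  assumes "\<sigma> \<in> {1, - 1}"
  shows "pos_sol p q (\<lambda>t. \<sigma> * w t) c d (\<sigma> * l) \<longleftrightarrow> pos_sol p q w c d l"
proof -
  have "q t - \<sigma> * l * (\<sigma> * w t) = q t - l * w t" for t using assms by auto
  then show ?thesis unfolding pos_sol_def by presburger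
qed

lemma sl_sol_join:
  assumes 1: "sl_sol p g c e u v" and 2: "sl_sol p g e d u v" and e: "c \<le> e" "e \<le> d"
  shows "sl_sol p g c d u v"
proof -
  have un: "{c..d} = {c..e} \<union> {e..d}" using e by auto
  have "(f has_real_derivative D) (at t within {c..d})"
    if l: "t \<in> {c..e} \<Longrightarrow> (f has_real_derivative D) (at t within {c..e})"
      and r: "t \<in> {e..d} \<Longrightarrow> (f has_real_derivative D) (at t within {e..d})" and "t \<in> {c..d}"
    for f D t
  proof -
    have "(f has_real_derivative D) (at t within {c..e})"
    proof (cases "t \<in> {c..e}")
      case False
      then have "at t within {c..e} = bot"
        by (metis at_within_eq_bot_iff closed_atLeastAtMost closed_limpt islimpt_def trivial_limit_within)
      then show ?thesis by (simp add: has_field_derivative_iff)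
    qed (rule l)
    moreover have "(f has_real_derivative D) (at t within {e..d})"
    proof (cases "t \<in> {e..d}")
      case False
      then have "at t within {e..d} = bot"
        by (metis at_within_eq_bot_iff closed_atLeastAtMost closed_limpt islimpt_def trivial_limit_within)
      then show ?thesis by (simp add: has_field_derivative_iff)
    qed (rule r)
    ultimately show ?thesis
      unfolding has_field_derivative_iff unfolding un at_within_union by (rule filterlim_sup)
  qed
  note join = this
  show ?thesis
    unfolding sl_sol_def
  proof (intro ballI conjI)
    fix t assume t: "t \<in> {c..d}"
    show "(u has_real_derivative v t / p t) (at t within {c..d})"
      by (rule join[OF _ _ t]) (use sl_sol_deriv[OF 1] sl_sol_deriv[OF 2] in blast)+
    show "(v has_real_derivative g t * u t) (at t within {c..d})"
      by (rule join[OF _ _ t]) (use sl_sol_deriv[OF 1] sl_sol_deriv[OF 2] in blast)+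
  qed
qed

lemma nonzero_constant_sign:
  fixes f :: "real \<Rightarrow> real"
  assumes "continuous_on {c..d} f" "\<And>t. t \<in> {c<..<d} \<Longrightarrow> f t \<noteq> 0"
  shows "(\<forall>t\<in>{c<..<d}. f t > 0) \<or> (\<forall>t\<in>{c<..<d}. f t < 0)"
proof -
  have "connected (f ` {c<..<d})"
    by (intro connected_continuous_image continuous_on_subset[OF assms(1)]) auto
  moreover have "0 \<notin> f ` {c<..<d}" using assms(2) by force
  ultimately have "\<not> (x < 0 \<and> y > 0)" if "x \<in> f ` {c<..<d}" "y \<in> f ` {c<..<d}" for x y
    using that connected_contains_Icc[of "f ` {c<..<d}" x y]
    by (meson atLeastAtMost_iff less_imp_le subsetD)
  then show ?thesis using assms(2)
    by (metis image_eqI linorder_neqE_linordered_idom)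
qed

context sl_problem
begin

lemma pos_sol_slopes:
  assumes sol: "sl_sol p (\<lambda>t. q t - l * w t) c d u v" and ends: "u c = 0" "u d = 0"
    and pos: "\<forall>t\<in>{c<..<d}. u t > 0"
  shows "v c > 0" "v d < 0"
proof -
  have mid: "(c + d) / 2 \<in> {c<..<d}" using cd by auto
  have nz: "v c \<noteq> 0" "v d \<noteq> 0"
    using sl_sol_zero(1)[OF sol order_refl order_refl, of c "(c + d) / 2"]
      sl_sol_zero(1)[OF sol order_refl order_refl, of d "(c + d) / 2"] pos[rule_format, OF mid] ends cd by auto
  have D: "(u has_real_derivative v t / p t) (at t within {c..d})" if "t \<in> {c..d}" for t
    by (rule sl_sol_deriv[OF sol that])
  have "\<not> v c < 0"
  proof
    assume "v c < 0"
    then have "v c / p c < 0" using pos_p[of c] cd by (auto intro: divide_neg_pos)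
    from has_real_derivative_neg_dec_right[OF D this] cd obtain r where
      r: "r > 0" "\<And>h. h > 0 \<Longrightarrow> c + h \<in> {c..d} \<Longrightarrow> h < r \<Longrightarrow> u (c + h) < u c"
      by auto
    define h where "h = min (r / 2) ((d - c) / 2)"
    have "h > 0" "h < r" "c + h < d" using r(1) cd by (auto simp: h_def min_def field_simps)
    then show False using r(2)[of h] pos[rule_format, of "c + h"] ends by auto
  qed
  then show "v c > 0" using nz by simp
  have "\<not> v d > 0"
  proof
    assume "v d > 0"
    then have "v d / p d > 0" using pos_p[of d] cd by auto
    from has_real_derivative_pos_inc_left[OF D this] cd obtain r where
      r: "r > 0" "\<And>h. h > 0 \<Longrightarrow> d - h \<in> {c..d} \<Longrightarrow> h < r \<Longrightarrow> u (d - h) < u d"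
      by auto
    define h where "h = min (r / 2) ((d - c) / 2)"
    have "h > 0" "h < r" "c < d - h" using r(1) cd by (auto simp: h_def min_def field_simps)
    then show False using r(2)[of h] pos[rule_format, of "d - h"] ends by auto
  qed
  then show "v d < 0" using nz by simp
qed

text \<open>Where the weight vanishes the parameter may be replaced by \<open>0\<close>, and \<open>0\<close> is not an
  eigenvalue because \<open>q \<ge> 0\<close>.\<close>
lemma pos_sol_weight_nonzero:
  assumes "pos_sol p q w c d l"
  shows "\<exists>t\<in>{c..d}. w t \<noteq> 0"
proof (rule ccontr)
  assume 0: "\<not> ?thesis"
  obtain u v where uv: "sl_sol p (\<lambda>t. q t - l * w t) c d u v" "u c = 0" "u d = 0"
    "\<forall>t\<in>{c<..<d}. u t > 0"
    using assms unfolding pos_sol_def by auto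
  have "sl_sol p (\<lambda>t. q t - 0 * w t) c d u v"
    by (rule sl_sol_cong[OF uv(1)]) (use 0 in auto)
  then have "pos_sol p q w c d 0" using uv unfolding pos_sol_def by blast
  then show False using pos_sol_iff[of d 0] shot_0_pos[of d] cd by simp
qed

end

text \<open>The slope at \<open>T1\<close> makes \<open>u\<close> positive before its zero \<open>t\<close>; the slope of that arch at \<open>t\<close> is
  negative, which makes \<open>u\<close> negative after \<open>t\<close>. Conversely the two arches are glued.\<close>
lemma C2_gt_iff:
  assumes 1: "sl_problem p q m T1 T2" and 2: "sl_problem p q n T1 T2"
  shows "(a, b) \<in> C2_gt T1 T2 p q m n \<longleftrightarrow>
    (\<exists>t. T1 < t \<and> t < T2 \<and> pos_sol p q m T1 t a \<and> pos_sol p q n t T2 b)"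
proof
  interpret M: sl_problem p q m T1 T2 by fact
  assume "(a, b) \<in> C2_gt T1 T2 p q m n"
  then obtain u where P: "solves_P T1 T2 p q m n a b u" and ex1: "\<exists>!t. t \<in> {T1<..<T2} \<and> u t = 0"
    and slope: "deriv_on T1 T2 u T1 > 0"
    unfolding C2_gt_def by blast
  obtain v where
    sol: "sl_sol p (\<lambda>t. q t - (if u t > 0 then a * m t else b * n t)) T1 T2 u v"
    and ends: "u T1 = 0" "u T2 = 0"
    using P unfolding solves_P_iff[OF 1 2] by blast
  obtain t where t': "t \<in> {T1<..<T2}" "u t = 0" and t4: "\<And>s. s \<in> {T1<..<T2} \<Longrightarrow> u s = 0 \<Longrightarrow> s = t"
    using ex1 by blast
  have t: "T1 < t" "t < T2" "u t = 0" using t' by simp_all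
  have D: "(u has_real_derivative v s / p s) (at s within {T1..T2})" if "s \<in> {T1..T2}" for s
    by (rule sl_sol_deriv[OF sol that])
  have vT1: "v T1 / p T1 > 0" using deriv_on_eq[OF M.cd _ D] slope M.cd by force
  have contu: "continuous_on {T1..T2} u" by (rule sl_sol_cont[OF sol])
  interpret L: sl_problem p q m T1 t by (rule sl_problem_subinterval[OF 1]) (use t in auto)
  have "(\<forall>s\<in>{T1<..<t}. u s > 0) \<or> (\<forall>s\<in>{T1<..<t}. u s < 0)"
    
  proof (rule nonzero_constant_sign)
    show "u s \<noteq> 0" if "s \<in> {T1<..<t}" for s using t4[of s] that t(2) by auto
  qed (use t in \<open>auto intro: continuous_on_subset[OF contu]\<close>)
  moreover have "\<not> (\<forall>s\<in>{T1<..<t}. u s < 0)"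
  proof
    assume neg: "\<forall>s\<in>{T1<..<t}. u s < 0"
    from has_real_derivative_pos_inc_right[OF D vT1] M.cd obtain r where
      r: "r > 0" "\<And>h. h > 0 \<Longrightarrow> T1 + h \<in> {T1..T2} \<Longrightarrow> h < r \<Longrightarrow> u T1 < u (T1 + h)"
      by auto
    define h where "h = min (r / 2) ((t - T1) / 2)"
    have "h > 0" "h < r" "T1 + h < t" using r(1) t by (auto simp: h_def min_def field_simps)
    then show False using r(2)[of h] neg[rule_format, of "T1 + h"] ends t by auto
  qed
  ultimately have pos: "\<forall>s\<in>{T1<..<t}. u s > 0" by blast
  have nonneg: "u s \<ge> 0" if "s \<in> {T1..t}" for s
    using pos ends t(3) that by (cases "s = T1 \<or> s = t") (auto intro: less_imp_le)
  have solL: "sl_sol p (\<lambda>t. q t - a * m t) T1 t u v"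
    by (rule sl_sol_cong[OF sl_sol_subinterval[OF sol]]) (use t nonneg in \<open>force+\<close>)
  have vt: "v t < 0" by (rule L.pos_sol_slopes[OF solL ends(1) t(3) pos])
  have "(\<forall>s\<in>{t<..<T2}. u s > 0) \<or> (\<forall>s\<in>{t<..<T2}. u s < 0)"
  proof (rule nonzero_constant_sign)
    show "u s \<noteq> 0" if "s \<in> {t<..<T2}" for s using t4[of s] that t(1) by auto
  qed (use t in \<open>auto intro: continuous_on_subset[OF contu]\<close>)
  moreover have "\<not> (\<forall>s\<in>{t<..<T2}. u s > 0)"
  proof
    assume neg: "\<forall>s\<in>{t<..<T2}. u s > 0"
    have "v t / p t < 0" using vt M.pos_p[of t] t by (auto intro: divide_neg_pos)
    from has_real_derivative_neg_dec_right[OF D this] t obtain r where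
      r: "r > 0" "\<And>h. h > 0 \<Longrightarrow> t + h \<in> {T1..T2} \<Longrightarrow> h < r \<Longrightarrow> u (t + h) < u t"
      by auto
    define h where "h = min (r / 2) ((T2 - t) / 2)"
    have "h > 0" "h < r" "t + h < T2" using r(1) t by (auto simp: h_def min_def field_simps)
    then show False using r(2)[of h] neg[rule_format, of "t + h"] t by auto
  qed
  ultimately have neg: "\<forall>s\<in>{t<..<T2}. u s < 0" by blast
  have nonpos: "u s \<le> 0" if "s \<in> {t..T2}" for s
    using neg ends t(3) that by (cases "s = T2 \<or> s = t") (auto intro: less_imp_le)
  have "sl_sol p (\<lambda>t. q t - b * n t) t T2 u v"
    by (rule sl_sol_cong[OF sl_sol_subinterval[OF sol]]) (use t nonpos in \<open>force+\<close>)
  from sl_sol_combine[OF this this, of "- 1" 0]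
  have "sl_sol p (\<lambda>t. q t - b * n t) t T2 (\<lambda>s. - u s) (\<lambda>s. - v s)" by simp
  then have "pos_sol p q n t T2 b" using neg t ends unfolding pos_sol_def by force
  moreover have "pos_sol p q m T1 t a" using solL pos t ends unfolding pos_sol_def by blast
  ultimately show "\<exists>t. T1 < t \<and> t < T2 \<and> pos_sol p q m T1 t a \<and> pos_sol p q n t T2 b"
    using t by blast
next
  interpret M: sl_problem p q m T1 T2 by fact
  assume "\<exists>t. T1 < t \<and> t < T2 \<and> pos_sol p q m T1 t a \<and> pos_sol p q n t T2 b"
  then obtain t u1 v1 u2 v2 where t: "T1 < t" "t < T2"
    and 1: "sl_sol p (\<lambda>t. q t - a * m t) T1 t u1 v1" "u1 T1 = 0" "u1 t = 0" "\<forall>s\<in>{T1<..<t}. u1 s > 0"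
    and 2: "sl_sol p (\<lambda>t. q t - b * n t) t T2 u2 v2" "u2 t = 0" "u2 T2 = 0" "\<forall>s\<in>{t<..<T2}. u2 s > 0"
    unfolding pos_sol_def by blast
  interpret L: sl_problem p q m T1 t by (rule sl_problem_subinterval[OF assms(1)]) (use t in auto)
  interpret R: sl_problem p q n t T2 by (rule sl_problem_subinterval[OF assms(2)]) (use t in auto)
  have s1: "v1 T1 > 0" "v1 t < 0" using L.pos_sol_slopes[OF 1] by auto
  have s2: "v2 t > 0" using R.pos_sol_slopes[OF 2] by auto
  \<comment> \<open>Scale the right arch so that the two slopes at the node agree.\<close>
  define k where "k = v1 t / v2 t"
  have k: "k < 0" using s1 s2 by (simp add: k_def divide_neg_pos)
  define u where "u = (\<lambda>s. if s \<le> t then u1 s else k * u2 s)"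
  define v where "v = (\<lambda>s. if s \<le> t then v1 s else k * v2 s)"
  have upos: "u s > 0" if "s \<in> {T1<..<t}" for s using that 1 by (auto simp: u_def)
  have uneg: "u s < 0" if "s \<in> {t<..<T2}" for s using that 2 k by (auto simp: u_def mult_neg_pos)
  have u0: "u T1 = 0" "u t = 0" "u T2 = 0" using 1 2 t by (auto simp: u_def)
  define g where "g = (\<lambda>s. q s - (if u s > 0 then a * m s else b * n s))"
  have "sl_sol p g T1 t u v"
  proof (rule sl_sol_cong[OF 1(1)])
    show "g s * u1 s = (q s - a * m s) * u1 s" if s: "s \<in> {T1..t}" for s
    proof (cases "s = T1 \<or> s = t")
      case False
      then show ?thesis using upos[of s] s by (simp add: g_def)
    qed (use 1 in auto)
  qed (auto simp: u_def v_def)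
  moreover have "sl_sol p g t T2 u v"
  proof (rule sl_sol_cong)
    show "sl_sol p (\<lambda>t. q t - b * n t) t T2 (\<lambda>s. k * u2 s) (\<lambda>s. k * v2 s)"
      using sl_sol_combine[OF 2(1) 2(1), of k 0] by simp
    show "u s = k * u2 s" "v s = k * v2 s" if "s \<in> {t..T2}" for s
      using that 1 2 s2 by (auto simp: u_def v_def k_def)
    show "g s * (k * u2 s) = (q s - b * n s) * (k * u2 s)" if s: "s \<in> {t..T2}" for s
    proof (cases "s = T2 \<or> s = t")
      case False
      then show ?thesis using uneg[of s] s by (simp add: g_def)
    qed (use 2 in auto)
  qed
  ultimately have sol: "sl_sol p g T1 T2 u v" using t sl_sol_join[of p g T1 t u v T2] by auto
  then have "solves_P T1 T2 p q m n a b u"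
    unfolding solves_P_iff[OF assms] g_def using u0 by blast
  moreover have "\<exists>!s. s \<in> {T1<..<T2} \<and> u s = 0"
  proof (rule ex1I[of _ t])
    show "s = t" if "s \<in> {T1<..<T2} \<and> u s = 0" for s
      using upos[of s] uneg[of s] that by (cases s t rule: linorder_cases) auto
  qed (use t u0 in auto)
  moreover have "deriv_on T1 T2 u T1 = v T1 / p T1"
    by (rule deriv_on_eq[OF M.cd]) (use sl_sol_deriv(1)[OF sol] M.cd in auto)
  then have "deriv_on T1 T2 u T1 > 0" using s1 t M.pos_p[of T1] M.cd by (simp add: v_def)
  ultimately show "(a, b) \<in> C2_gt T1 T2 p q m n" unfolding C2_gt_def by blast
qed

lemma solves_P_uminus:
  assumes "sl_problem p q m T1 T2" "sl_problem p q n T1 T2" "solves_P T1 T2 p q m n a b u"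
  shows "solves_P T1 T2 p q n m b a (\<lambda>t. - u t)"
proof -
  obtain v where "sl_sol p (\<lambda>t. q t - (if u t > 0 then a * m t else b * n t)) T1 T2 u v"
    and ends: "u T1 = 0" "u T2 = 0"
    using assms(3) unfolding solves_P_iff[OF assms(1,2)] by blast
  from sl_sol_combine[OF this(1) this(1), of "- 1" 0]
  have "sl_sol p (\<lambda>t. q t - (if u t > 0 then a * m t else b * n t)) T1 T2 (\<lambda>t. - u t) (\<lambda>t. - v t)"
    by simp
  then have "sl_sol p (\<lambda>t. q t - (if - u t > 0 then b * n t else a * m t)) T1 T2 (\<lambda>t. - u t) (\<lambda>t. - v t)"
    by (rule sl_sol_cong) auto
  then show ?thesis using ends unfolding solves_P_iff[OF assms(2,1)] by auto
qed

lemma deriv_on_uminus: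
  assumes "T1 < T2" "C1_on T1 T2 u"
  shows "deriv_on T1 T2 (\<lambda>t. - u t) T1 = - deriv_on T1 T2 u T1"
  using DERIV_minus[OF C1_on_deriv[OF assms(2)]] assms(1) by (intro deriv_on_eq) auto

lemma C2_lt_swap:
  assumes "sl_problem p q m T1 T2" "sl_problem p q n T1 T2"
  shows "(a, b) \<in> C2_lt T1 T2 p q m n \<longleftrightarrow> (b, a) \<in> C2_gt T1 T2 p q n m"
proof
  have "T1 < T2" using assms(1) by (simp add: sl_problem_def)
  note flip = deriv_on_uminus[OF this]
  assume "(a, b) \<in> C2_lt T1 T2 p q m n"
  then obtain u where u: "solves_P T1 T2 p q m n a b u" "\<exists>!t. t \<in> {T1<..<T2} \<and> u t = 0"
    "deriv_on T1 T2 u T1 < 0"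
    unfolding C2_lt_def by blast
  show "(b, a) \<in> C2_gt T1 T2 p q n m"
    unfolding C2_gt_def
  proof (clarify, intro exI[of _ "\<lambda>t. - u t"] conjI)
    show "solves_P T1 T2 p q n m b a (\<lambda>t. - u t)" by (rule solves_P_uminus[OF assms u(1)])
  qed (use flip[of u] u in \<open>simp_all add: solves_P_def SL_regular_def\<close>)
next
  have "T1 < T2" using assms(1) by (simp add: sl_problem_def)
  note flip = deriv_on_uminus[OF this]
  assume "(b, a) \<in> C2_gt T1 T2 p q n m"
  then obtain u where u: "solves_P T1 T2 p q n m b a u" "\<exists>!t. t \<in> {T1<..<T2} \<and> u t = 0"
    "deriv_on T1 T2 u T1 > 0"
    unfolding C2_gt_def by blast
  show "(a, b) \<in> C2_lt T1 T2 p q m n"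
    unfolding C2_lt_def
  proof (clarify, intro exI[of _ "\<lambda>t. - u t"] conjI)
    show "solves_P T1 T2 p q m n a b (\<lambda>t. - u t)" by (rule solves_P_uminus[OF assms(2,1) u(1)])
  qed (use flip[of u] u in \<open>simp_all add: solves_P_def SL_regular_def\<close>)
qed

section \<open>Asymptotes and supports\<close>

lemma eventually_going_to_at_infinity:
  fixes f :: "'a \<Rightarrow> real"
  shows "eventually P (f going_to at_infinity within C) \<longleftrightarrow> (\<exists>A. \<forall>z\<in>C. A \<le> \<bar>f z\<bar> \<longrightarrow> P z)"
  unfolding going_to_within_def eventually_inf_principal eventually_filtercomap eventually_at_infinity
  by (auto simp: real_norm_def)

lemma asymptotic_horizontal_swap:
  "asymptotic_horizontal (prod.swap ` C) \<alpha> \<longleftrightarrow> asymptotic_vertical C \<alpha>"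
  unfolding asymptotic_horizontal_def asymptotic_vertical_def tendsto_iff trivial_limit_def
    eventually_going_to_at_infinity by simp

lemma not_asymptotic_vertical:
  assumes "\<delta> > 0" "\<And>x y. (x, y) \<in> C \<Longrightarrow> \<delta> \<le> \<bar>x - \<alpha>\<bar>"
  shows "\<not> asymptotic_vertical C \<alpha>"
proof
  assume "asymptotic_vertical C \<alpha>"
  then have nb: "\<not> eventually (\<lambda>_. False) (snd going_to at_infinity within C)"
    and "eventually (\<lambda>z. dist (fst z) \<alpha> < \<delta>) (snd going_to at_infinity within C)"
    using assms(1) unfolding asymptotic_vertical_def tendsto_iff trivial_limit_def by blast+
  then obtain A where "\<And>z. z \<in> C \<Longrightarrow> A \<le> \<bar>snd z\<bar> \<Longrightarrow> \<bar>fst z - \<alpha>\<bar> < \<delta>"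
    unfolding eventually_going_to_at_infinity dist_real_def by blast
  then have "eventually (\<lambda>_. False) (snd going_to at_infinity within C)"
    unfolding eventually_going_to_at_infinity using assms(2) by (intro exI[of _ A]) force
  then show False using nb by blast
qed

text \<open>The signs \<open>\<sigma>\<close> and \<open>\<tau>\<close> select the quadrant, so that all hypotheses concern positive
  quantities.\<close>
lemma asymptotic_horizontalI:
  assumes sg: "\<sigma> \<in> {1, - 1}" "\<tau> \<in> {1, - 1}"
    and near: "\<And>\<epsilon>. \<epsilon> > 0 \<Longrightarrow> \<exists>A. \<forall>x y. (x, y) \<in> D \<longrightarrow> A < \<sigma> * x \<longrightarrow> 0 < \<tau> * y \<longrightarrow> \<bar>\<tau> * y - \<beta>\<bar> < \<epsilon>"
    and far: "\<And>A. \<exists>x y. (x, y) \<in> D \<and> A < \<sigma> * x \<and> 0 < \<sigma> * x \<and> 0 < \<tau> * y"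
  shows "asymptotic_horizontal (D \<inter> {(x, y). 0 < \<sigma> * x \<and> 0 < \<tau> * y}) (\<tau> * \<beta>)"
proof -
  define C where "C = D \<inter> {(x, y). 0 < \<sigma> * x \<and> 0 < \<tau> * y}"
  have abs: "\<bar>x\<bar> = \<sigma> * x" if "0 < \<sigma> * x" for x using sg(1) that by auto
  have dist: "\<bar>y - \<tau> * \<beta>\<bar> = \<bar>\<tau> * y - \<beta>\<bar>" for y using sg(2) by auto
  have "fst going_to at_infinity within C \<noteq> bot"
  proof
    assume "fst going_to at_infinity within C = bot"
    then obtain A where A: "\<And>z. z \<in> C \<Longrightarrow> A \<le> \<bar>fst z\<bar> \<Longrightarrow> False"
      unfolding trivial_limit_def eventually_going_to_at_infinity by blast
    obtain x y where "(x, y) \<in> D" "A < \<sigma> * x" "0 < \<sigma> * x" "0 < \<tau> * y" using far[of A] by blast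
    then show False using A[of "(x, y)"] abs[of x] by (auto simp: C_def)
  qed
  moreover have "(snd \<longlongrightarrow> \<tau> * \<beta>) (fst going_to at_infinity within C)"
    unfolding tendsto_iff eventually_going_to_at_infinity
  proof (intro allI impI)
    fix \<epsilon> :: real assume "\<epsilon> > 0"
    then obtain A where A: "\<And>x y. (x, y) \<in> D \<Longrightarrow> A < \<sigma> * x \<Longrightarrow> 0 < \<tau> * y \<Longrightarrow> \<bar>\<tau> * y - \<beta>\<bar> < \<epsilon>"
      using near by blast
    show "\<exists>A. \<forall>z\<in>C. A \<le> \<bar>fst z\<bar> \<longrightarrow> dist (snd z) (\<tau> * \<beta>) < \<epsilon>"
    proof (intro exI[of _ "A + 1"] ballI impI)
      fix z assume z: "z \<in> C" "A + 1 \<le> \<bar>fst z\<bar>"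
      obtain x y where xy: "z = (x, y)" by (cases z)
      then show "dist (snd z) (\<tau> * \<beta>) < \<epsilon>"
        using A[of x y] abs[of x] z dist[of y] by (auto simp: C_def dist_real_def)
    qed
  qed
  ultimately show ?thesis unfolding asymptotic_horizontal_def C_def by blast
qed

lemma sign_quadrant:
  assumes "\<sigma> \<in> {1, - 1}" "\<tau> \<in> {1, - 1 :: real}"
  shows "{(x, y). 0 < \<sigma> * x \<and> 0 < \<tau> * y} \<in> open_quadrants"
proof -
  have "{(x, y). 0 < \<sigma> * x \<and> 0 < \<tau> * y} = {x. 0 < \<sigma> * x} \<times> {y. 0 < \<tau> * y}" by auto
  moreover have "{x. 0 < \<sigma> * x} = (if \<sigma> = 1 then {0<..} else {..<0})" if "\<sigma> \<in> {1, - 1 :: real}" for \<sigma>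
    using that by auto
  ultimately show ?thesis using assms by (auto simp: open_quadrants_def)
qed

lemma swap_first_curves:
  assumes "sl_problem p q m T1 T2" "sl_problem p q n T1 T2" "C \<in> first_curves T1 T2 p q m n"
  shows "prod.swap ` C \<in> first_curves T1 T2 p q n m"
proof -
  obtain D Q where C: "C = D \<inter> Q" and D: "D \<in> {C2_gt T1 T2 p q m n, C2_lt T1 T2 p q m n}"
    and Q: "Q \<in> open_quadrants" and ne: "D \<inter> Q \<noteq> {}"
    using assms(3) unfolding first_curves_def by blast
  have img: "prod.swap ` X = {(y, x). (x, y) \<in> X}" for X :: "(real \<times> real) set"
    by force
  have "prod.swap ` C2_gt T1 T2 p q m n = C2_lt T1 T2 p q n m"
    unfolding img using C2_lt_swap[OF assms(2,1)] by auto
  moreover have "prod.swap ` C2_lt T1 T2 p q m n = C2_gt T1 T2 p q n m"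
    unfolding img using C2_lt_swap[OF assms(1,2)] by auto
  ultimately have D': "prod.swap ` D \<in> {C2_gt T1 T2 p q n m, C2_lt T1 T2 p q n m}"
    using D by blast
  have Q': "prod.swap ` Q \<in> open_quadrants"
  proof -
    have "prod.swap ` (X \<times> Y) = Y \<times> X" for X Y :: "real set" by auto
    note swap_Times = this
    show ?thesis
      using Q unfolding open_quadrants_def
      by (elim insertE emptyE) (simp_all only: swap_Times insert_iff simp_thms)
  qed
  have C': "prod.swap ` C = prod.swap ` D \<inter> prod.swap ` Q"
    unfolding C img by auto
  have "prod.swap ` C \<noteq> {}" using ne C by simp
  then have "prod.swap ` D \<inter> prod.swap ` Q \<noteq> {}" unfolding C' .
  then have "prod.swap ` C = prod.swap ` D \<inter> prod.swap ` Q \<and>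
      prod.swap ` D \<in> {C2_gt T1 T2 p q n m, C2_lt T1 T2 p q n m} \<and>
      prod.swap ` Q \<in> open_quadrants \<and> prod.swap ` D \<inter> prod.swap ` Q \<noteq> {}"
    using C' D' Q' by blast
  then show ?thesis
    unfolding first_curves_def mem_Collect_eq
    by (intro exI[of _ "prod.swap ` D"] exI[of _ "prod.swap ` Q"])
qed

lemma trivial_gap_left:
  assumes w: "sl_problem p q w T1 T2" and "\<alpha> \<in> trivial_values T1 T2 p q w" "s < T2"
  shows "\<exists>\<delta>>0. \<forall>t l. T1 < t \<longrightarrow> t \<le> s \<longrightarrow> pos_sol p q w T1 t l \<longrightarrow> \<delta> \<le> \<bar>l - \<alpha>\<bar>"
proof -
  obtain \<sigma> where \<sigma>: "\<sigma> \<in> {1, - 1}" "first_eig p q (\<lambda>t. \<sigma> * w t) T1 T2 (\<sigma> * \<alpha>)"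
    using trivial_values_sign[OF assms(1,2)] by blast
  have "\<bar>\<sigma> * l - \<sigma> * \<alpha>\<bar> = \<bar>l - \<alpha>\<bar>" for l using \<sigma>(1) by auto
  note dist = this
  obtain \<delta> where \<delta>: "\<delta> > 0" "\<And>t l. T1 < t \<Longrightarrow> t \<le> s \<Longrightarrow>
      pos_sol p q (\<lambda>t. \<sigma> * w t) T1 t l \<Longrightarrow> \<delta> \<le> \<bar>l - \<sigma> * \<alpha>\<bar>"
    using sl_problem.first_eig_gap[OF sl_problem_sign[OF w] \<sigma>(2) assms(3)] by blast
  have "\<delta> \<le> \<bar>l - \<alpha>\<bar>" if "T1 < t" "t \<le> s" "pos_sol p q w T1 t l" for t l
    using \<delta>(2)[of t "\<sigma> * l"] that unfolding pos_sol_sign[OF \<sigma>(1)] dist by blast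
  then show ?thesis using \<delta>(1) by blast
qed

lemma trivial_gap_right:
  assumes w: "sl_problem p q w T1 T2" and "\<alpha> \<in> trivial_values T1 T2 p q w" "T1 < s"
  shows "\<exists>\<delta>>0. \<forall>t l. s \<le> t \<longrightarrow> t < T2 \<longrightarrow> pos_sol p q w t T2 l \<longrightarrow> \<delta> \<le> \<bar>l - \<alpha>\<bar>"
proof -
  obtain \<sigma> where \<sigma>: "\<sigma> \<in> {1, - 1}" "first_eig p q (\<lambda>t. \<sigma> * w t) T1 T2 (\<sigma> * \<alpha>)"
    using trivial_values_sign[OF assms(1,2)] by blast
  have "\<bar>\<sigma> * l - \<sigma> * \<alpha>\<bar> = \<bar>l - \<alpha>\<bar>" for l using \<sigma>(1) by auto
  note dist = this
  obtain \<delta> where \<delta>: "\<delta> > 0" "\<And>t l. s \<le> t \<Longrightarrow> t < T2 \<Longrightarrow>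
      pos_sol p q (\<lambda>t. \<sigma> * w t) t T2 l \<Longrightarrow> \<delta> \<le> \<bar>l - \<sigma> * \<alpha>\<bar>"
    using first_eig_gap_right[OF sl_problem_sign[OF w] \<sigma>(2) assms(3)] by blast
  have "\<delta> \<le> \<bar>l - \<alpha>\<bar>" if "s \<le> t" "t < T2" "pos_sol p q w t T2 l" for t l
    using \<delta>(2)[of t "\<sigma> * l"] that unfolding pos_sol_sign[OF \<sigma>(1)] dist by blast
  then show ?thesis using \<delta>(1) by blast
qed

lemma compact_support_iff:
  "compact_support T1 T2 w \<longleftrightarrow>
    T1 \<notin> closure {t \<in> {T1..T2}. w t \<noteq> 0} \<and> T2 \<notin> closure {t \<in> {T1..T2}. w t \<noteq> 0}"
proof -
  have "closure {t \<in> {T1..T2}. w t \<noteq> 0} \<subseteq> {T1..T2}"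
    by (rule closure_minimal) auto
  moreover have "{T1<..<T2} = {T1..T2} - {T1, T2}" by auto
  ultimately show ?thesis unfolding compact_support_def by blast
qed

text \<open>The arch for \<open>w2\<close> must meet the support of \<open>w2\<close>, which keeps \<open>t\<close> away from \<open>T2\<close>.\<close>
lemma no_asymptote_left:
  assumes 1: "sl_problem p q w1 T1 T2" and 2: "sl_problem p q w2 T1 T2"
    and cs: "compact_support T1 T2 w2" and \<alpha>: "\<alpha> \<in> trivial_values T1 T2 p q w1"
  shows "\<exists>\<delta>>0. \<forall>t x y. T1 < t \<longrightarrow> t < T2 \<longrightarrow> pos_sol p q w1 T1 t x \<longrightarrow> pos_sol p q w2 t T2 y \<longrightarrow> \<delta> \<le> \<bar>x - \<alpha>\<bar>"
proof -
  obtain e where e: "e > 0" "\<And>t. t \<in> {T1..T2} \<Longrightarrow> w2 t \<noteq> 0 \<Longrightarrow> e \<le> \<bar>t - T2\<bar>"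
    using cs unfolding compact_support_iff closure_approachable dist_real_def by force
  obtain \<delta> where \<delta>: "\<delta> > 0" "\<And>t l. T1 < t \<Longrightarrow> t \<le> T2 - e \<Longrightarrow> pos_sol p q w1 T1 t l \<Longrightarrow> \<delta> \<le> \<bar>l - \<alpha>\<bar>"
    using trivial_gap_left[OF 1 \<alpha>, of "T2 - e"] e(1) by auto
  have "t \<le> T2 - e" if t: "T1 < t" "t < T2" "pos_sol p q w2 t T2 y" for t y
  proof -
    obtain s where "s \<in> {t..T2}" "w2 s \<noteq> 0"
      using sl_problem.pos_sol_weight_nonzero[OF sl_problem_subinterval[OF 2, of t T2] t(3)] t by auto
    then show ?thesis using e(2)[of s] t by auto
  qed
  then show ?thesis using \<delta> by blast
qed

lemma no_asymptote_right:
  assumes 1: "sl_problem p q w1 T1 T2" and 2: "sl_problem p q w2 T1 T2"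
    and cs: "compact_support T1 T2 w2" and \<alpha>: "\<alpha> \<in> trivial_values T1 T2 p q w1"
  shows "\<exists>\<delta>>0. \<forall>t x y. T1 < t \<longrightarrow> t < T2 \<longrightarrow> pos_sol p q w1 t T2 x \<longrightarrow> pos_sol p q w2 T1 t y \<longrightarrow> \<delta> \<le> \<bar>x - \<alpha>\<bar>"
proof -
  obtain e where e: "e > 0" "\<And>t. t \<in> {T1..T2} \<Longrightarrow> w2 t \<noteq> 0 \<Longrightarrow> e \<le> \<bar>t - T1\<bar>"
    using cs unfolding compact_support_iff closure_approachable dist_real_def by force
  obtain \<delta> where \<delta>: "\<delta> > 0" "\<And>t l. T1 + e \<le> t \<Longrightarrow> t < T2 \<Longrightarrow> pos_sol p q w1 t T2 l \<Longrightarrow> \<delta> \<le> \<bar>l - \<alpha>\<bar>"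
    using trivial_gap_right[OF 1 \<alpha>, of "T1 + e"] e(1) by auto
  have "T1 + e \<le> t" if t: "T1 < t" "t < T2" "pos_sol p q w2 T1 t y" for t y
  proof -
    obtain s where "s \<in> {T1..t}" "w2 s \<noteq> 0"
      using sl_problem.pos_sol_weight_nonzero[OF sl_problem_subinterval[OF 2, of T1 t] t(3)] t by auto
    then show ?thesis using e(2)[of s] t by auto
  qed
  then show ?thesis using \<delta> by blast
qed

lemma compact_support_imp_no_vertical_asymptote:
  assumes 1: "sl_problem p q m T1 T2" and 2: "sl_problem p q n T1 T2"
    and cs: "compact_support T1 T2 n"
    and C: "C \<in> first_curves T1 T2 p q m n" and \<alpha>: "\<alpha> \<in> trivial_values T1 T2 p q m"
  shows "\<not> asymptotic_vertical C \<alpha>"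
proof -
  consider "C \<subseteq> C2_gt T1 T2 p q m n" | "C \<subseteq> C2_lt T1 T2 p q m n"
    using C unfolding first_curves_def by blast
  then show ?thesis
  proof cases
    case 1
    obtain \<delta> where "\<delta> > 0" "\<And>t x y. T1 < t \<Longrightarrow> t < T2 \<Longrightarrow> pos_sol p q m T1 t x \<Longrightarrow> pos_sol p q n t T2 y \<Longrightarrow> \<delta> \<le> \<bar>x - \<alpha>\<bar>"
      using no_asymptote_left[OF assms(1,2) cs \<alpha>] by blast
    then show ?thesis
      using 1 C2_gt_iff[OF assms(1,2)] by (intro not_asymptotic_vertical[of \<delta>]) blast+
  next
    case 2
    obtain \<delta> where "\<delta> > 0" "\<And>t x y. T1 < t \<Longrightarrow> t < T2 \<Longrightarrow> pos_sol p q m t T2 x \<Longrightarrow> pos_sol p q n T1 t y \<Longrightarrow> \<delta> \<le> \<bar>x - \<alpha>\<bar>"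
      using no_asymptote_right[OF assms(1,2) cs \<alpha>] by blast
    then show ?thesis
      using 2 C2_gt_iff[OF assms(2,1)] C2_lt_swap[OF assms(1,2)]
      by (intro not_asymptotic_vertical[of \<delta>]) blast+
  qed
qed

text \<open>The point \<open>s\<close> may be an end point; by continuity \<open>w\<close> is then nonzero at interior points as well.\<close>
lemma sign_near_point:
  fixes w :: "real \<Rightarrow> real"
  assumes cont: "continuous_on {T1..T2} w" and "a < b" "{a<..<b} \<subseteq> {T1..T2}"
    and nz: "s \<in> {a..b}" "w s \<noteq> 0" "s \<in> {T1..T2}"
  shows "\<exists>\<sigma>\<in>{1, - 1}. \<exists>r\<in>{a<..<b}. \<sigma> * w r > 0"
proof (rule ccontr)
  assume no: "\<not> ?thesis"
  have 0: "w r = 0" if "r \<in> {a<..<b}" for r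
    using no that by (auto simp: not_less) (metis order_antisym greaterThanLessThan_iff)
  have cl: "closure {a<..<b} = {a..b}" using \<open>a < b\<close> by (rule closure_greaterThanLessThan)
  have sub: "{a..b} \<subseteq> {T1..T2}"
    using closure_mono[OF assms(3)] unfolding cl by simp
  have "w s = 0"
    using continuous_constant_on_closure[of "{a<..<b}" w 0 s] 0 nz(1) continuous_on_subset[OF cont sub]
    unfolding cl by blast
  then show False using nz by simp
qed

text \<open>One of the two signs has to occur arbitrarily close to \<open>T2\<close>.\<close>
lemma sign_accumulates_right:
  fixes w :: "real \<Rightarrow> real"
  assumes cont: "continuous_on {T1..T2} w"
    and cl: "T2 \<in> closure {t \<in> {T1..T2}. w t \<noteq> 0}"
  shows "\<exists>\<sigma>\<in>{1, - 1}. \<forall>z. T1 \<le> z \<longrightarrow> z < T2 \<longrightarrow> (\<exists>s\<in>{z<..<T2}. \<sigma> * w s > 0)"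
proof (rule ccontr)
  assume no: "\<not> ?thesis"
  then obtain z1 where z1: "T1 \<le> z1" "z1 < T2" "\<not> (\<exists>s\<in>{z1<..<T2}. 1 * w s > 0)" by blast
  from no obtain z2 where z2: "T1 \<le> z2" "z2 < T2" "\<not> (\<exists>s\<in>{z2<..<T2}. - 1 * w s > 0)" by blast
  define z where "z = max z1 z2"
  have z: "T1 \<le> z" "z < T2" using z1 z2 by (auto simp: z_def)
  obtain s where "s \<in> {T1..T2}" "w s \<noteq> 0" "dist s T2 < T2 - z"
    using cl z unfolding closure_approachable by (metis (mono_tags, lifting) diff_gt_0_iff_gt mem_Collect_eq)
  then have "\<exists>\<sigma>\<in>{1, - 1}. \<exists>r\<in>{z<..<T2}. \<sigma> * w r > 0"
    using z by (intro sign_near_point[OF cont, of _ _ s]) (auto simp: dist_real_def)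
  then obtain \<sigma> r where "\<sigma> \<in> {1, - 1}" "r \<in> {z<..<T2}" "\<sigma> * w r > 0" by blast
  then show False using z1(3) z2(3) by (auto simp: z_def)
qed

lemma sign_accumulates_left:
  fixes w :: "real \<Rightarrow> real"
  assumes cont: "continuous_on {T1..T2} w"
    and cl: "T1 \<in> closure {t \<in> {T1..T2}. w t \<noteq> 0}"
  shows "\<exists>\<sigma>\<in>{1, - 1}. \<forall>z. T1 < z \<longrightarrow> z \<le> T2 \<longrightarrow> (\<exists>s\<in>{T1<..<z}. \<sigma> * w s > 0)"
proof (rule ccontr)
  assume no: "\<not> ?thesis"
  then obtain z1 where z1: "T1 < z1" "z1 \<le> T2" "\<not> (\<exists>s\<in>{T1<..<z1}. 1 * w s > 0)" by blast
  from no obtain z2 where z2: "T1 < z2" "z2 \<le> T2" "\<not> (\<exists>s\<in>{T1<..<z2}. - 1 * w s > 0)" by blast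
  define z where "z = min z1 z2"
  have z: "T1 < z" "z \<le> T2" using z1 z2 by (auto simp: z_def)
  obtain s where "s \<in> {T1..T2}" "w s \<noteq> 0" "dist s T1 < z - T1"
    using cl z unfolding closure_approachable by (metis (mono_tags, lifting) diff_gt_0_iff_gt mem_Collect_eq)
  then have "\<exists>\<sigma>\<in>{1, - 1}. \<exists>r\<in>{T1<..<z}. \<sigma> * w r > 0"
    using z by (intro sign_near_point[OF cont, of _ _ s]) (auto simp: dist_real_def)
  then obtain \<sigma> r where "\<sigma> \<in> {1, - 1}" "r \<in> {T1<..<z}" "\<sigma> * w r > 0" by blast
  then show False using z1(3) z2(3) by (auto simp: z_def)
qed

text \<open>The arch for \<open>m\<close> is placed at the end point at which the values of \<open>m\<close> accumulate: after the arch
  for \<open>n\<close> for \<open>T2\<close>, before it for \<open>T1\<close>. As it shrinks, \<open>a\<close> tends to infinity while the arch for \<open>n\<close>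
  exhausts the interval.\<close>
lemma horizontal_asymptote_if_not_compact_support:
  assumes 1: "sl_problem p q m T1 T2" and 2: "sl_problem p q n T1 T2"
    and n: "\<exists>t\<in>{T1..T2}. n t \<noteq> 0" and cs: "\<not> compact_support T1 T2 m"
  shows "\<exists>C\<in>first_curves T1 T2 p q m n. \<exists>\<beta>\<in>trivial_values T1 T2 p q n. asymptotic_horizontal C \<beta>"
proof -
  interpret M: sl_problem p q m T1 T2 by fact
  interpret N: sl_problem p q n T1 T2 by fact
  obtain \<tau> r where \<tau>: "\<tau> \<in> {1, - 1}" and r: "r \<in> {T1<..<T2}" "\<tau> * n r > 0"
  proof -
    obtain s where "s \<in> {T1..T2}" "n s \<noteq> 0" using n by blast
    then have "\<exists>\<sigma>\<in>{1, - 1}. \<exists>r\<in>{T1<..<T2}. \<sigma> * n r > 0"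
      using N.cd by (intro sign_near_point[OF N.contw, of _ _ s]) auto
    then show ?thesis using that by blast
  qed
  have goal: ?thesis
    if \<sigma>: "\<sigma> \<in> {1, - 1}" and D: "D \<in> {C2_gt T1 T2 p q m n, C2_lt T1 T2 p q m n}"
      and \<beta>: "first_eig p q (\<lambda>t. \<tau> * n t) T1 T2 \<beta>"
      and near: "\<And>\<epsilon>. \<epsilon> > 0 \<Longrightarrow> \<exists>A. \<forall>x y. (x, y) \<in> D \<longrightarrow> A < \<sigma> * x \<longrightarrow> 0 < \<tau> * y \<longrightarrow> \<bar>\<tau> * y - \<beta>\<bar> < \<epsilon>"
      and far: "\<And>A. \<exists>x y. (x, y) \<in> D \<and> A < \<sigma> * x \<and> 0 < \<sigma> * x \<and> 0 < \<tau> * y" for \<sigma> D \<beta>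
  proof (intro bexI)
    show "asymptotic_horizontal (D \<inter> {(x, y). 0 < \<sigma> * x \<and> 0 < \<tau> * y}) (\<tau> * \<beta>)"
      using asymptotic_horizontalI[OF \<sigma> \<tau> near far] .
    show "\<tau> * \<beta> \<in> trivial_values T1 T2 p q n" using sign_trivial_values[OF 2 \<tau> \<beta>] .
    have "D \<inter> {(x, y). 0 < \<sigma> * x \<and> 0 < \<tau> * y} \<noteq> {}" using far[of 0] by blast
    then show "D \<inter> {(x, y). 0 < \<sigma> * x \<and> 0 < \<tau> * y} \<in> first_curves T1 T2 p q m n"
      unfolding first_curves_def using D sign_quadrant[OF \<sigma> \<tau>] by blast
  qed
  have un: "pos_sol p q (\<lambda>t. \<sigma> * w t) c d x \<longleftrightarrow> pos_sol p q w c d (\<sigma> * x)" if "\<sigma> \<in> {1, - 1}" for \<sigma> w c d x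
    using pos_sol_sign[OF that, of p q w c d "\<sigma> * x"] that by auto
  have ss: "\<sigma> * (\<sigma> * x) = x" if "\<sigma> \<in> {1, - 1}" for \<sigma> x :: real using that by auto
  consider "T2 \<in> closure {t \<in> {T1..T2}. m t \<noteq> 0}" | "T1 \<in> closure {t \<in> {T1..T2}. m t \<noteq> 0}"
    using cs unfolding compact_support_iff by blast
  then show ?thesis
  proof cases
    case 1
    obtain \<sigma> where \<sigma>: "\<sigma> \<in> {1, - 1}"
      and acc: "\<And>z. T1 \<le> z \<Longrightarrow> z < T2 \<Longrightarrow> \<exists>s\<in>{z<..<T2}. \<sigma> * m s > 0"
      using sign_accumulates_right[OF M.contw 1] by blast
    from weight_at_right_end[OF sl_problem_sign[OF 2] sl_problem_sign[OF assms(1)] r acc]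
    obtain \<beta> where \<beta>: "first_eig p q (\<lambda>t. \<tau> * n t) T1 T2 \<beta>"
      and near: "\<And>\<epsilon>. \<epsilon> > 0 \<Longrightarrow> \<exists>A. \<forall>t x y. T1 < t \<longrightarrow> t < T2 \<longrightarrow> A < x \<longrightarrow> 0 < y \<longrightarrow>
        pos_sol p q n T1 t (\<tau> * y) \<longrightarrow> pos_sol p q m t T2 (\<sigma> * x) \<longrightarrow> \<bar>y - \<beta>\<bar> < \<epsilon>"
      and far: "\<And>A. \<exists>t x y. T1 < t \<and> t < T2 \<and> A < x \<and> 0 < x \<and> 0 < y \<and>
        pos_sol p q n T1 t (\<tau> * y) \<and> pos_sol p q m t T2 (\<sigma> * x)"
      unfolding un[OF \<sigma>] un[OF \<tau>] by blast
    have D: "(x, y) \<in> C2_lt T1 T2 p q m n \<longleftrightarrow>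
        (\<exists>t. T1 < t \<and> t < T2 \<and> pos_sol p q n T1 t y \<and> pos_sol p q m t T2 x)" for x y
      using C2_lt_swap[OF assms(1,2)] C2_gt_iff[OF assms(2,1)] by simp
    show ?thesis
    proof (rule goal[OF \<sigma> _ \<beta>, of "C2_lt T1 T2 p q m n"])
      fix \<epsilon> :: real assume "\<epsilon> > 0"
      from near[OF this] obtain A where "\<And>t x y. T1 < t \<Longrightarrow> t < T2 \<Longrightarrow> A < x \<Longrightarrow> 0 < y \<Longrightarrow>
        pos_sol p q n T1 t (\<tau> * y) \<Longrightarrow> pos_sol p q m t T2 (\<sigma> * x) \<Longrightarrow> \<bar>y - \<beta>\<bar> < \<epsilon>" by blast
      from this[of _ "\<sigma> * _" "\<tau> * _", unfolded ss[OF \<sigma>] ss[OF \<tau>]]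
      show "\<exists>A. \<forall>x y. (x, y) \<in> C2_lt T1 T2 p q m n \<longrightarrow> A < \<sigma> * x \<longrightarrow> 0 < \<tau> * y \<longrightarrow> \<bar>\<tau> * y - \<beta>\<bar> < \<epsilon>"
        unfolding D by blast
    next
      fix A
      obtain t x y where "T1 < t" "t < T2" "A < x" "0 < x" "0 < y"
        "pos_sol p q n T1 t (\<tau> * y)" "pos_sol p q m t T2 (\<sigma> * x)" using far by blast
      then show "\<exists>x y. (x, y) \<in> C2_lt T1 T2 p q m n \<and> A < \<sigma> * x \<and> 0 < \<sigma> * x \<and> 0 < \<tau> * y"
        unfolding D by (intro exI[of _ "\<sigma> * x"] exI[of _ "\<tau> * y"]) (auto simp: ss[OF \<sigma>] ss[OF \<tau>])
    qed simp
  next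
    case 2
    obtain \<sigma> where \<sigma>: "\<sigma> \<in> {1, - 1}"
      and acc: "\<And>z. T1 < z \<Longrightarrow> z \<le> T2 \<Longrightarrow> \<exists>s\<in>{T1<..<z}. \<sigma> * m s > 0"
      using sign_accumulates_left[OF M.contw 2] by blast
    from weight_at_left_end[OF sl_problem_sign[OF assms(2)] sl_problem_sign[OF assms(1)] r acc]
    obtain \<beta> where \<beta>: "first_eig p q (\<lambda>t. \<tau> * n t) T1 T2 \<beta>"
      and near: "\<And>\<epsilon>. \<epsilon> > 0 \<Longrightarrow> \<exists>A. \<forall>t x y. T1 < t \<longrightarrow> t < T2 \<longrightarrow> A < x \<longrightarrow> 0 < y \<longrightarrow>
        pos_sol p q n t T2 (\<tau> * y) \<longrightarrow> pos_sol p q m T1 t (\<sigma> * x) \<longrightarrow> \<bar>y - \<beta>\<bar> < \<epsilon>"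
      and far: "\<And>A. \<exists>t x y. T1 < t \<and> t < T2 \<and> A < x \<and> 0 < x \<and> 0 < y \<and>
        pos_sol p q n t T2 (\<tau> * y) \<and> pos_sol p q m T1 t (\<sigma> * x)"
      unfolding un[OF \<sigma>] un[OF \<tau>] by blast
    note D = C2_gt_iff[OF assms(1,2)]
    show ?thesis
    proof (rule goal[OF \<sigma> _ \<beta>, of "C2_gt T1 T2 p q m n"])
      fix \<epsilon> :: real assume "\<epsilon> > 0"
      from near[OF this] obtain A where "\<And>t x y. T1 < t \<Longrightarrow> t < T2 \<Longrightarrow> A < x \<Longrightarrow> 0 < y \<Longrightarrow>
        pos_sol p q n t T2 (\<tau> * y) \<Longrightarrow> pos_sol p q m T1 t (\<sigma> * x) \<Longrightarrow> \<bar>y - \<beta>\<bar> < \<epsilon>" by blast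
      from this[of _ "\<sigma> * _" "\<tau> * _", unfolded ss[OF \<sigma>] ss[OF \<tau>]]
      show "\<exists>A. \<forall>x y. (x, y) \<in> C2_gt T1 T2 p q m n \<longrightarrow> A < \<sigma> * x \<longrightarrow> 0 < \<tau> * y \<longrightarrow> \<bar>\<tau> * y - \<beta>\<bar> < \<epsilon>"
        unfolding D by blast
    next
      fix A
      obtain t x y where "T1 < t" "t < T2" "A < x" "0 < x" "0 < y"
        "pos_sol p q n t T2 (\<tau> * y)" "pos_sol p q m T1 t (\<sigma> * x)" using far by blast
      then show "\<exists>x y. (x, y) \<in> C2_gt T1 T2 p q m n \<and> A < \<sigma> * x \<and> 0 < \<sigma> * x \<and> 0 < \<tau> * y"
        unfolding D by (intro exI[of _ "\<sigma> * x"] exI[of _ "\<tau> * y"]) (auto simp: ss[OF \<sigma>] ss[OF \<tau>])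
    qed simp
  qed
qed

theorem corollary5p4:
  fixes T1 T2 :: real and p q m n :: "real \<Rightarrow> real"
  assumes "T1 < T2"
    and "continuous_on {T1..T2} p" and "continuous_on {T1..T2} q"
    and "continuous_on {T1..T2} m" and "continuous_on {T1..T2} n"
    and "\<And>t. t \<in> {T1..T2} \<Longrightarrow> p t > 0"
    and "\<And>t. t \<in> {T1..T2} \<Longrightarrow> q t \<ge> 0"
    and "\<exists>t\<in>{T1..T2}. m t \<noteq> 0" and "\<exists>t\<in>{T1..T2}. n t \<noteq> 0"
  shows "(compact_support T1 T2 m \<and> compact_support T1 T2 n) \<longleftrightarrow>
    (\<forall>C \<in> first_curves T1 T2 p q m n.
       (\<forall>\<alpha> \<in> trivial_values T1 T2 p q m. \<not> asymptotic_vertical C \<alpha>) \<and>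
       (\<forall>\<beta> \<in> trivial_values T1 T2 p q n. \<not> asymptotic_horizontal C \<beta>))"
proof -
  have M: "sl_problem p q m T1 T2" and N: "sl_problem p q n T1 T2"
    using assms by (auto simp: sl_problem_def)
  have swap: "prod.swap ` prod.swap ` C = C" for C :: "(real \<times> real) set"
    by (simp add: image_image)
  have horiz: "asymptotic_vertical (prod.swap ` C) \<beta> \<longleftrightarrow> asymptotic_horizontal C \<beta>" for C \<beta>
    using asymptotic_horizontal_swap[of "prod.swap ` C" \<beta>] by (simp add: swap)
  show ?thesis
  proof
    assume cs: "compact_support T1 T2 m \<and> compact_support T1 T2 n"
    show "\<forall>C \<in> first_curves T1 T2 p q m n.
       (\<forall>\<alpha> \<in> trivial_values T1 T2 p q m. \<not> asymptotic_vertical C \<alpha>) \<and>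
       (\<forall>\<beta> \<in> trivial_values T1 T2 p q n. \<not> asymptotic_horizontal C \<beta>)"
      using compact_support_imp_no_vertical_asymptote[OF M N]
        compact_support_imp_no_vertical_asymptote[OF N M] swap_first_curves[OF M N] cs horiz by blast
  next
    assume R: "\<forall>C \<in> first_curves T1 T2 p q m n.
       (\<forall>\<alpha> \<in> trivial_values T1 T2 p q m. \<not> asymptotic_vertical C \<alpha>) \<and>
       (\<forall>\<beta> \<in> trivial_values T1 T2 p q n. \<not> asymptotic_horizontal C \<beta>)"
    have "compact_support T1 T2 m"
      using horizontal_asymptote_if_not_compact_support[OF M N assms(9)] R by blast
    moreover have "compact_support T1 T2 n"
    proof (rule ccontr)
      assume "\<not> compact_support T1 T2 n"
      then obtain C \<alpha> where C: "C \<in> first_curves T1 T2 p q n m" "\<alpha> \<in> trivial_values T1 T2 p q m"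
        "asymptotic_horizontal C \<alpha>"
        using horizontal_asymptote_if_not_compact_support[OF N M assms(8)] by blast
      then have "asymptotic_vertical (prod.swap ` C) \<alpha>" by (simp add: horiz)
      then show False using R swap_first_curves[OF N M C(1)] C(2) by blast
    qed
    ultimately show "compact_support T1 T2 m \<and> compact_support T1 T2 n" by blast
  qed
qed

end
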